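(* For each pair $(p,s)\in\{(2,2),(3,3),(4,4),(5,6)\}$ there exists an explicit Runge--Kutta method with $s$ stages, $c_s=1$ and order $p$, whose associated RKRLS method (which requires $s-1$ effective stages per step) also has order $p$.
   Context: An explicit $s$-stage Runge--Kutta (RK) method $(A,b)$ is given by a strictly lower triangular real matrix $A=(a_{ij})_{1\le i,j\le s}$ and $b\in\mathbb{R}^s$, with nodes $c=Ae$, $e=(1,\dots,1)^T\in\mathbb{R}^s$ (so $c_1=0$). One step of size $h$ for $y'=f(t,y)$ from $(t_n,y_n)$ is $y_{n+1}=y_n+h\sum_{i=1}^s b_i f_{n,i}$, where $f_{n,i}=f\big(t_n+c_ih,\;y_n+h\sum_{j<i}a_{ij}f_{n,j}\big)$ for $i=1,\dots,s$. The same formulas define the RK step for coefficients with any number of stages. The values $s=2,3,4,6$ are the (well-known) minimum numbers of stages of explicit RK methods of orders $2,3,4,5$. The associated RKRLS method (RK method reusing the last stage, assuming $c_s=1$) uses the same formulas except that in every step after the first one the first stage is replaced by the last stage of the previous step: $f_{n,1}:=f_{n-1,s}$ for $n\ge1$, while $f_{0,1}=f(t_0,y_0)$. Hence, except in the first step, only $s-1$ function evaluations are needed per step. An RK method has (local) order $p$ if, for every initial value problem with sufficiently smooth $f$, its error after one step of size $h$ from exact data is $\mathcal{O}(h^{p+1})$ as $h\to0$ ("order $p$" means order at least $p$); equivalently, its coefficients satisfy the Butcher order conditions for all rooted trees with at most $p$ vertices. Let $a=(a_{s1},\dots,a_{s,s-1},0)^T$ be the last row of $A$ (as a column vector), $e_1=(1,0,\dots,0)^T\in\mathbb{R}^s$,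 $M=e_1(a-b)^T$ and $E=eb^T+M$. For $n\ge 2$, $n$ consecutive steps of size $h$ of the RKRLS method are one step of size $H=nh$ of the $ns$-stage RK method $(\widehat A^{(n)},\widehat b^{(n)})$, called the $n$-step composed method, where $\widehat b^{(n)}=\frac1n(b^T,\dots,b^T)^T\in\mathbb{R}^{ns}$ and $\widehat A^{(n)}$ is $\frac1n$ times the $n\times n$ block lower triangular matrix with $s\times s$ blocks: $A$ in each diagonal block, $E$ in each block of the first block subdiagonal, $eb^T$ in every block below that, and $0$ above the diagonal. Definition: the RKRLS method has (local) order $p$ if, for every $n\ge2$, the $n$-step composed method $(\widehat A^{(n)},\widehat b^{(n)})$ has local order $p$. *)

theory Defs
  imports "HOL-Analysis.Analysis" "HOL-Library.Landau_Symbols"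
begin

text \<open>
  Conventions. Stages are numbered \<open>0, \<dots>, s - 1\<close>, so the first stage has index \<open>0\<close> and the last one
  \<open>s - 1\<close>; only the entries \<open>A i j\<close>, \<open>b i\<close> with \<open>i, j < s\<close> matter. The dimension of a system of ODEs
  has to be quantified inside the notion of order, so the real \<open>m\<close>-space is the library's
  \<^const>\<open>Euclidean_space\<close> \<open>m\<close>: functions from \<open>nat\<close> to \<open>real\<close> vanishing at all indices \<open>\<ge> m\<close>.
\<close>

definition explicit_rk :: "nat \<Rightarrow> (nat \<Rightarrow> nat \<Rightarrow> real) \<Rightarrow> bool" where
  "explicit_rk s A \<longleftrightarrow> (\<forall>i<s. \<forall>j<s. i \<le> j \<longrightarrow> A i j = 0)"

definition rk_node :: "nat \<Rightarrow> (nat \<Rightarrow> nat \<Rightarrow> real) \<Rightarrow> nat \<Rightarrow> real" where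
  "rk_node s A i = (\<Sum>j<s. A i j)"

text \<open>\<open>rk_stage s A f t y h i\<close> is the stage derivative \<open>f\<^sub>n\<^sub>,\<^sub>i\<close> of the step of size \<open>h\<close> from \<open>(t, y)\<close>.\<close>

function rk_stage ::
  "nat \<Rightarrow> (nat \<Rightarrow> nat \<Rightarrow> real) \<Rightarrow> (real \<Rightarrow> (nat \<Rightarrow> real) \<Rightarrow> nat \<Rightarrow> real)
    \<Rightarrow> real \<Rightarrow> (nat \<Rightarrow> real) \<Rightarrow> real \<Rightarrow> nat \<Rightarrow> nat \<Rightarrow> real" where
  "rk_stage s A f t y h i =
     f (t + rk_node s A i * h) (\<lambda>k. y k + h * (\<Sum>j<i. A i j * rk_stage s A f t y h j k))"
  by pat_completeness auto
termination
  by (relation "Wellfounded.measure (\<lambda>(s, A, f, t, y, h, i). i)") auto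

declare rk_stage.simps [simp del]

definition rk_step ::
  "nat \<Rightarrow> (nat \<Rightarrow> nat \<Rightarrow> real) \<Rightarrow> (nat \<Rightarrow> real) \<Rightarrow> (real \<Rightarrow> (nat \<Rightarrow> real) \<Rightarrow> nat \<Rightarrow> real)
    \<Rightarrow> real \<Rightarrow> (nat \<Rightarrow> real) \<Rightarrow> real \<Rightarrow> nat \<Rightarrow> real" where
  "rk_step s A b f t y h = (\<lambda>k. y k + h * (\<Sum>i<s. b i * rk_stage s A f t y h i k))"

text \<open>
  \<open>Ck_on m r D g\<close>: the scalar function \<open>g\<close> of \<open>(t, x\<^sub>0, \<dots>, x\<^sub>m\<^sub>-\<^sub>1)\<close> is of class \<open>C\<^sup>r\<close> on \<open>D\<close>, that is, all
  its iterated partial derivatives of order at most \<open>r\<close> exist and are continuous on \<open>D\<close>. It is used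
  for relatively open subsets \<open>D\<close> of the product of the real line and \<^const>\<open>Euclidean_space\<close> \<open>m\<close>.
\<close>

primrec Ck_on ::
  "nat \<Rightarrow> nat \<Rightarrow> (real \<times> (nat \<Rightarrow> real)) set \<Rightarrow> (real \<times> (nat \<Rightarrow> real) \<Rightarrow> real) \<Rightarrow> bool" where
  "Ck_on m 0 D g \<longleftrightarrow> continuous_on D g"
| "Ck_on m (Suc r) D g \<longleftrightarrow> continuous_on D g \<and>
     (\<exists>g'. Ck_on m r D g' \<and>
        (\<forall>(t, x)\<in>D. ((\<lambda>u. g (u, x)) has_real_derivative g' (t, x)) (at t))) \<and>
     (\<forall>j<m. \<exists>g'. Ck_on m r D g' \<and>
        (\<forall>(t, x)\<in>D. ((\<lambda>u. g (t, x(j := u))) has_real_derivative g' (t, x)) (at (x j))))"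

text \<open>The right-hand side \<open>f\<close> of an \<open>m\<close>-dimensional system, defined and of class \<open>C\<^sup>r\<close> on the open set \<open>D\<close>.\<close>

definition Ck_system ::
  "nat \<Rightarrow> nat \<Rightarrow> (real \<times> (nat \<Rightarrow> real)) set \<Rightarrow> (real \<Rightarrow> (nat \<Rightarrow> real) \<Rightarrow> nat \<Rightarrow> real) \<Rightarrow> bool" where
  "Ck_system m r D f \<longleftrightarrow>
     openin (prod_topology euclideanreal (Euclidean_space m)) D \<and>
     (\<forall>(t, x)\<in>D. f t x \<in> topspace (Euclidean_space m)) \<and>
     (\<forall>k<m. Ck_on m r D (\<lambda>(t, x). f t x k))"

definition solves_system ::
  "nat \<Rightarrow> (real \<times> (nat \<Rightarrow> real)) set \<Rightarrow> (real \<Rightarrow> (nat \<Rightarrow> real) \<Rightarrow> nat \<Rightarrow> real)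
    \<Rightarrow> (real \<Rightarrow> nat \<Rightarrow> real) \<Rightarrow> real set \<Rightarrow> bool" where
  "solves_system m D f y I \<longleftrightarrow>
     (\<forall>t\<in>I. (t, y t) \<in> D \<and> (\<forall>k<m. ((\<lambda>u. y u k) has_real_derivative f t (y t) k) (at t)))"

text \<open>
  Local order (at least) \<open>p\<close>. ``Sufficiently smooth'' is read as: there is a differentiability class
  \<open>C\<^sup>r\<close> such that the error estimate holds for all initial value problems, in every dimension,
  with right-hand side in this class.
\<close>

definition rk_has_order ::
  "nat \<Rightarrow> nat \<Rightarrow> (nat \<Rightarrow> nat \<Rightarrow> real) \<Rightarrow> (nat \<Rightarrow> real) \<Rightarrow> bool" where
  "rk_has_order p s A b \<longleftrightarrow>
     (\<exists>r. \<forall>m D f y t0 \<epsilon>.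
        Ck_system m r D f \<longrightarrow> \<epsilon> > 0 \<longrightarrow> solves_system m D f y {t0 - \<epsilon><..<t0 + \<epsilon>} \<longrightarrow>
        (\<forall>k<m. (\<lambda>h. y (t0 + h) k - rk_step s A b f t0 (y t0) h k) \<in> O[at 0](\<lambda>h. h ^ (p + 1))))"

text \<open>
  The matrices \<open>E = e b\<^sup>T + M\<close> with \<open>M = e\<^sub>1 (a - b)\<^sup>T\<close>, where \<open>a\<close> is the last row of \<open>A\<close>, and the
  coefficients of the \<open>n\<close>-step composed method of the RKRLS method associated with \<open>(A, b)\<close>, in
  which the first stage of every step but the first is the last stage of the previous step. The entry
  with index \<open>i\<close> belongs to the block \<open>i div s\<close> and has position \<open>i mod s\<close> in this block.
\<close>

definition rkrls_M :: "nat \<Rightarrow> (nat \<Rightarrow> nat \<Rightarrow> real) \<Rightarrow> (nat \<Rightarrow> real) \<Rightarrow> nat \<Rightarrow> nat \<Rightarrow> real" where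
  "rkrls_M s A b i j = (if i = 0 then A (s - 1) j - b j else 0)"

definition rkrls_E :: "nat \<Rightarrow> (nat \<Rightarrow> nat \<Rightarrow> real) \<Rightarrow> (nat \<Rightarrow> real) \<Rightarrow> nat \<Rightarrow> nat \<Rightarrow> real" where
  "rkrls_E s A b i j = b j + rkrls_M s A b i j"

definition composed_A ::
  "nat \<Rightarrow> nat \<Rightarrow> (nat \<Rightarrow> nat \<Rightarrow> real) \<Rightarrow> (nat \<Rightarrow> real) \<Rightarrow> nat \<Rightarrow> nat \<Rightarrow> real" where
  "composed_A n s A b i j = 1 / real n *
     (if j div s = i div s then A (i mod s) (j mod s)
      else if j div s + 1 = i div s then rkrls_E s A b (i mod s) (j mod s)
      else if j div s + 1 < i div s then b (j mod s)
      else 0)"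

definition composed_b :: "nat \<Rightarrow> nat \<Rightarrow> (nat \<Rightarrow> real) \<Rightarrow> nat \<Rightarrow> real" where
  "composed_b n s b i = 1 / real n * b (i mod s)"

definition rkrls_has_order ::
  "nat \<Rightarrow> nat \<Rightarrow> (nat \<Rightarrow> nat \<Rightarrow> real) \<Rightarrow> (nat \<Rightarrow> real) \<Rightarrow> bool" where
  "rkrls_has_order p s A b \<longleftrightarrow>
     (\<forall>n\<ge>2. rk_has_order p (n * s) (composed_A n s A b) (composed_b n s b))"

end

theory Submission
  imports Defs
begin

text \<open>
  Why the theorem holds. Let \<open>e\<^sub>i\<close> be the error of the \<open>i\<close>-th internal stage value of one step, compared with
  the exact solution \<open>y\<close> at the node \<open>c\<^sub>i\<close>. With the Jacobian \<open>J\<close> of \<open>f\<close> along the solution,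
  \<open>e = d + h A (J e) + O(h e\<^sup>2)\<close>, where \<open>d\<close> collects the errors of the quadrature formulas given by the rows
  of \<open>A\<close>, applied to the derivative of \<open>y\<close>. As the nodes are the row sums of \<open>A\<close>, \<open>e = O(h\<^sup>2)\<close>, and the quadratic
  part changes the result of the step by \<open>O(h\<^sup>5)\<close> only. So up to order four the elaborate tree conditions
  reduce to linear ones: \<open>b\<close> integrates polynomials well enough, and all products of \<open>b\<^sup>T\<close>, powers of
  \<open>C = diag c\<close>, factors \<open>A\<close>, and the defects of the stages vanish as far as they matter. For order five
  it suffices that, in addition, \<open>b\<close> does not see the stages whose error is not \<open>O(h\<^sup>3)\<close>. This is
  \<open>rk_conditions\<close>, and \<open>rk_conditions_imp_order\<close> proves that it implies the order by expanding all
  quantities in powers of \<open>h\<close>: the proof uses expansions of \<open>f\<close> and of its Jacobian along the solution and a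
  second order bound for the remainder of the linearization in the state.

  In the composed method, every block inherits the defects of \<open>(A, b)\<close>, shifted binomially, because \<open>b\<close>
  integrates the preceding blocks exactly. The only new term is a multiple of the unit vector of the
  first stage of each block: the reused slope was computed at the last stage value of the preceding
  step and not at its result. If this last stage value is of order \<open>q\<close>, the multiple vanishes for the
  first \<open>q\<close> defects, so that it suffices that the linear conditions hold for the unit vector of the
  first stage with \<open>p - q - 1\<close> powers of \<open>h\<close> remaining (\<open>rk_conditions_composed\<close>). For \<open>p = 2\<close>, \<open>q = 1\<close> this
  is no condition; for \<open>p = 3\<close>, \<open>q = 1\<close> it says \<open>b\<^sub>1 = 0\<close>; for \<open>p = 4\<close>, \<open>q = 1\<close> and for \<open>p = 5\<close>, \<open>q = 2\<close> it says \<open>b\<^sub>1 = 0\<close>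
  and \<open>(b\<^sup>T A)\<^sub>1 = 0\<close>. Suitable methods exist: for \<open>p = 4\<close> there is one with nodes
  \<open>0, 1/2, 0, 1\<close>, and for \<open>p = 5\<close> the condition \<open>b\<^sub>1 = 0\<close> is one equation for the nodes of a family of six-stage
  methods.
\<close>

section \<open>Sufficient conditions for order at most five\<close>

text \<open>
  The rows of \<open>A\<close> are quadrature formulas on the intervals from \<open>0\<close> to the nodes; this is their error on
  the monomial of degree \<open>k\<close>. In the stage error it comes with \<open>h ^ Suc k\<close> and a Taylor coefficient of \<open>y'\<close>.
\<close>

definition defect :: "nat \<Rightarrow> (nat \<Rightarrow> nat \<Rightarrow> real) \<Rightarrow> nat \<Rightarrow> nat \<Rightarrow> real" where
  "defect s A k i = (\<Sum>j<s. A i j * rk_node s A j ^ k) - rk_node s A i ^ Suc k / real (Suc k)"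

lemma defect_0: "defect s A 0 = (\<lambda>i. 0)"
  by (simp add: defect_def rk_node_def fun_eq_iff)

text \<open>
  Suppose that \<open>v\<close> occurs in the stage errors at some power of \<open>h\<close>. Expanding the Jacobian in the node
  (which produces the factors \<open>c\<^sub>i ^ m\<close>), a linear step of the recursion sends \<open>v\<close> to \<open>A C\<^sup>m v\<close> at \<open>Suc m\<close>
  powers of \<open>h\<close> more, and the final combination contributes \<open>b\<^sup>T C\<^sup>m v\<close>, likewise at \<open>Suc m\<close> powers more.
  The predicate says that nothing that starts from \<open>v\<close> reaches the result of the step within the next
  \<open>r\<close> powers of \<open>h\<close>.
\<close>

fun annihilated :: "nat \<Rightarrow> (nat \<Rightarrow> nat \<Rightarrow> real) \<Rightarrow> (nat \<Rightarrow> real) \<Rightarrow> nat \<Rightarrow> (nat \<Rightarrow> real) \<Rightarrow> bool" where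
  "annihilated s A b r v \<longleftrightarrow>
     (\<forall>m<r. (\<Sum>i<s. b i * rk_node s A i ^ m * v i) = 0 \<and>
        annihilated s A b (r - Suc m) (\<lambda>i. \<Sum>j<s. A i j * rk_node s A j ^ m * v j))"

declare annihilated.simps [simp del]

lemma annihilated_0 [simp]: "annihilated s A b 0 v"
  unfolding annihilated.simps[of s A b 0 v] by simp

lemma annihilatedI:
  assumes "\<And>m. m < r \<Longrightarrow> (\<Sum>i<s. b i * rk_node s A i ^ m * v i) = 0"
    and "\<And>m. m < r \<Longrightarrow> annihilated s A b (r - Suc m) (\<lambda>i. \<Sum>j<s. A i j * rk_node s A j ^ m * v j)"
  shows "annihilated s A b r v"
  unfolding annihilated.simps[of s A b r v] using assms by simp

lemma annihilated_weight:
  assumes "annihilated s A b r v" "m < r"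
  shows "(\<Sum>i<s. b i * rk_node s A i ^ m * v i) = 0"
  using assms(1)[unfolded annihilated.simps[of s A b r v]] assms(2) by simp

lemma annihilated_apply:
  assumes "annihilated s A b r v" "m < r"
  shows "annihilated s A b (r - Suc m) (\<lambda>i. \<Sum>j<s. A i j * rk_node s A j ^ m * v j)"
  using assms(1)[unfolded annihilated.simps[of s A b r v]] assms(2) by simp

lemma annihilated_mono:
  assumes "annihilated s A b r v" "r' \<le> r"
  shows "annihilated s A b r' v"
  using assms
proof (induction r' arbitrary: r v rule: less_induct)
  case (less r')
  show ?case
  proof (rule annihilatedI)
    fix m assume "m < r'"
    then show "(\<Sum>i<s. b i * rk_node s A i ^ m * v i) = 0"
      using less.prems annihilated_weight by force
    show "annihilated s A b (r' - Suc m) (\<lambda>i. \<Sum>j<s. A i j * rk_node s A j ^ m * v j)"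
    proof (rule less.IH)
      show "annihilated s A b (r - Suc m) (\<lambda>i. \<Sum>j<s. A i j * rk_node s A j ^ m * v j)"
        using \<open>m < r'\<close> less.prems by (intro annihilated_apply) auto
    qed (use \<open>m < r'\<close> less.prems in auto)
  qed
qed

lemma annihilated_cong:
  assumes "annihilated s A b r v" "\<And>i. i < s \<Longrightarrow> v i = w i"
  shows "annihilated s A b r w"
proof (rule annihilatedI)
  fix m assume m: "m < r"
  show "(\<Sum>i<s. b i * rk_node s A i ^ m * w i) = 0"
    using annihilated_weight[OF assms(1) m] assms(2) by simp
  show "annihilated s A b (r - Suc m) (\<lambda>i. \<Sum>j<s. A i j * rk_node s A j ^ m * w j)"
    using annihilated_apply[OF assms(1) m] assms(2) by simp
qed

lemma annihilated_zero: "annihilated s A b r (\<lambda>i. 0)"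
proof (induction r rule: less_induct)
  case (less r)
  show ?case by (rule annihilatedI) (simp_all add: less.IH)
qed

lemma annihilated_add:
  assumes "annihilated s A b r v" "annihilated s A b r w"
  shows "annihilated s A b r (\<lambda>i. v i + w i)"
  using assms
proof (induction r arbitrary: v w rule: less_induct)
  case (less r)
  show ?case
  proof (rule annihilatedI)
    fix m assume m: "m < r"
    show "(\<Sum>i<s. b i * rk_node s A i ^ m * (v i + w i)) = 0"
      using less.prems m by (simp add: distrib_left sum.distrib annihilated_weight)
    show "annihilated s A b (r - Suc m) (\<lambda>i. \<Sum>j<s. A i j * rk_node s A j ^ m * (v j + w j))"
      using less.IH[OF _ annihilated_apply[OF less.prems(1) m] annihilated_apply[OF less.prems(2) m]] m
      by (simp add: distrib_left sum.distrib)
  qed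
qed

lemma annihilated_scale:
  assumes "annihilated s A b r v"
  shows "annihilated s A b r (\<lambda>i. a * v i)"
  using assms
proof (induction r arbitrary: v rule: less_induct)
  case (less r)
  show ?case
  proof (rule annihilatedI)
    fix m assume m: "m < r"
    show "(\<Sum>i<s. b i * rk_node s A i ^ m * (a * v i)) = 0"
      using annihilated_weight[OF less.prems m]
      by (simp add: mult.left_commute[of _ a] flip: sum_distrib_left)
    show "annihilated s A b (r - Suc m) (\<lambda>i. \<Sum>j<s. A i j * rk_node s A j ^ m * (a * v j))"
      using less.IH[OF _ annihilated_apply[OF less.prems m]] m
      by (simp add: mult.left_commute[of _ a] flip: sum_distrib_left)
  qed
qed

lemma annihilated_sum:
  assumes "\<And>l. l \<in> L \<Longrightarrow> annihilated s A b r (w l)"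
  shows "annihilated s A b r (\<lambda>i. \<Sum>l\<in>L. \<alpha> l * w l i)"
  using assms
proof (induction L rule: infinite_finite_induct)
  case (insert x F)
  then show ?case
    using annihilated_add[OF annihilated_scale[of s A b r "w x" "\<alpha> x"], of "\<lambda>i. \<Sum>l\<in>F. \<alpha> l * w l i"]
    by simp
qed (simp_all add: annihilated_zero)

text \<open>
  The last clause controls the quadratic terms: where \<open>defect s A 1\<close> vanishes, the stage error is \<open>O(h\<^sup>3)\<close>.
  In \<open>p - Suc k\<close>, truncated subtraction makes the condition void for the defects that only enter beyond
  order \<open>p\<close>.
\<close>

definition rk_conditions :: "nat \<Rightarrow> nat \<Rightarrow> (nat \<Rightarrow> nat \<Rightarrow> real) \<Rightarrow> (nat \<Rightarrow> real) \<Rightarrow> bool" where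
  "rk_conditions p s A b \<longleftrightarrow>
     explicit_rk s A \<and>
     (\<forall>k<p. (\<Sum>i<s. b i * rk_node s A i ^ k) = 1 / real (Suc k)) \<and>
     (\<forall>k. annihilated s A b (p - Suc k) (defect s A k)) \<and>
     (p \<le> 4 \<or> p = 5 \<and> (\<forall>i<s. b i * defect s A 1 i = 0))"


section \<open>The composed method of a reused last stage\<close>

lemma sum_blocks:
  fixes F :: "nat \<Rightarrow> 'a::comm_monoid_add"
  shows "(\<Sum>i<n * s. F i) = (\<Sum>I<n. \<Sum>i<s. F (I * s + i))"
proof -
  have "(\<Sum>i<n * s. F i) = (\<Sum>I<n. sum F {I * s..<I * s + s})"
    by (simp add: sum.nat_group)
  also have "\<dots> = (\<Sum>I<n. \<Sum>i<s. F (I * s + i))"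
  proof (rule sum.cong[OF refl])
    fix I
    show "sum F {I * s..<I * s + s} = (\<Sum>i<s. F (I * s + i))"
      by (rule sum.reindex_bij_witness[where i="\<lambda>i. I * s + i" and j="\<lambda>i. i - I * s"]) auto
  qed
  finally show ?thesis .
qed

text \<open>
  The preceding blocks enter with the weights \<open>b\<close> alone, as if the exact Runge-Kutta steps were
  concatenated; reusing the last stage only adds the correction \<open>a - b\<close> in the row of the first stage.
\<close>

lemma composed_apply:
  assumes "I < n" "i < s"
  shows "(\<Sum>j<n * s. composed_A n s A b (I * s + i) j * w j) =
    ((\<Sum>j<s. A i j * w (I * s + j)) + (\<Sum>J<I. \<Sum>j<s. b j * w (J * s + j)) +
     (if i = 0 \<and> I > 0 then \<Sum>j<s. (A (s - 1) j - b j) * w ((I - 1) * s + j) else 0)) / real n"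
proof -
  define X where "X = (\<lambda>J. \<Sum>j<s. A i j * w (J * s + j))"
  define Y where "Y = (\<lambda>J. \<Sum>j<s. b j * w (J * s + j))"
  define Z where "Z = (\<lambda>J. if i = 0 then \<Sum>j<s. (A (s - 1) j - b j) * w (J * s + j) else 0)"
  have "(\<Sum>j<n * s. composed_A n s A b (I * s + i) j * w j) =
     (\<Sum>J<n. ((if J = I then X J else 0) + (if J < I then Y J else 0) + (if Suc J = I then Z J else 0)) / real n)"
    unfolding sum_blocks
    using assms
    by (intro sum.cong refl)
       (auto simp: composed_A_def rkrls_E_def rkrls_M_def X_def Y_def Z_def sum_divide_distrib
          sum.distrib[symmetric] algebra_simps add_divide_distrib intro!: sum.cong)
  also have "\<dots> = ((\<Sum>J<n. if J = I then X J else 0) + (\<Sum>J<n. if J < I then Y J else 0)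
      + (\<Sum>J<n. if Suc J = I then Z J else 0)) / real n"
    by (simp only: sum.distrib flip: sum_divide_distrib)
  also have "(\<Sum>J<n. if J = I then X J else 0) = X I"
    using assms by simp
  also have "(\<Sum>J<n. if J < I then Y J else 0) = (\<Sum>J<I. Y J)"
    using assms by (intro sum.mono_neutral_cong_right) auto
  also have "(\<Sum>J<n. if Suc J = I then Z J else 0) = (if I > 0 then Z (I - 1) else 0)"
  proof (cases I)
    case (Suc K)
    then show ?thesis using assms by simp
  qed simp
  finally show ?thesis
    by (auto simp: X_def Y_def Z_def)
qed

text \<open>
  Here \<open>q\<close> is the order of the last stage value as an approximation of the solution at the end of the
  step. The bound \<open>q \<le> 2\<close> ensures that \<open>first_stage\<close> also covers the reuse corrections that arise when \<open>A\<close>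
  is applied to a defect: these come at least three powers of \<open>h\<close> late, and \<open>p - 3 \<le> p - Suc q\<close>.
\<close>

locale reuse =
  fixes p q n s :: nat and A :: "nat \<Rightarrow> nat \<Rightarrow> real" and b :: "nat \<Rightarrow> real"
  assumes cond: "rk_conditions p s A b"
    and p: "p \<ge> 1" and s: "s \<ge> 1" and n: "n \<ge> 1"
    and last_node: "rk_node s A (s - 1) = 1"
    and last_quad: "\<And>k. k < q \<Longrightarrow> defect s A k (s - 1) = 0"
    and first_stage: "annihilated s A b (p - Suc q) (\<lambda>i. if i = 0 then 1 else 0)"
    and q: "1 \<le> q" "q \<le> 2" "p \<le> 4 \<or> q = 2" "q \<le> p"
begin

abbreviation c where "c \<equiv> rk_node s A"
abbreviation comp_A where "comp_A \<equiv> composed_A n s A b"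
abbreviation comp_b where "comp_b \<equiv> composed_b n s b"
abbreviation unit0 :: "nat \<Rightarrow> real" where "unit0 \<equiv> (\<lambda>i. if i = 0 then 1 else 0)"

lemma quad: "k < p \<Longrightarrow> (\<Sum>i<s. b i * c i ^ k) = 1 / real (Suc k)"
  using cond by (simp add: rk_conditions_def)

lemma row_sum: "(\<Sum>j<s. A i j) = c i" by (simp add: rk_node_def)

lemma sum_b: "(\<Sum>i<s. b i) = 1" using quad[of 0] p by simp

lemma composed_node:
  assumes "I < n" "i < s"
  shows "rk_node (n * s) comp_A (I * s + i) = (real I + c i) / real n"
proof -
  have "rk_node (n * s) comp_A (I * s + i) = (\<Sum>j<n * s. comp_A (I * s + i) j * 1)"
    by (simp add: rk_node_def)
  also have "\<dots> = (real I + c i) / real n"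
    by (subst composed_apply[OF assms, where w="\<lambda>_. 1"])
       (auto simp: sum_b row_sum sum_subtractf last_node[unfolded One_nat_def])
  finally show ?thesis .
qed

lemma shifted_power:
  "(\<Sum>j<s. w j * (x + c j) ^ k * v j) = (\<Sum>l\<le>k. (real (k choose l) * x ^ (k - l)) * (\<Sum>j<s. w j * c j ^ l * v j))"
proof -
  have "(\<Sum>j<s. w j * (x + c j) ^ k * v j) =
     (\<Sum>j<s. \<Sum>l\<le>k. (real (k choose l) * x ^ (k - l)) * (w j * c j ^ l * v j))"
    by (intro sum.cong refl, subst add.commute, subst binomial_ring)
       (simp add: sum_distrib_left sum_distrib_right mult_ac)
  also have "\<dots> = (\<Sum>l\<le>k. (real (k choose l) * x ^ (k - l)) * (\<Sum>j<s. w j * c j ^ l * v j))"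
    by (subst sum.swap) (simp add: sum_distrib_left)
  finally show ?thesis .
qed

text \<open>
  The integral of \<open>(x + t) ^ k\<close> over \<open>t\<close> from \<open>0\<close> to \<open>y\<close>, evaluated term by term and in closed form.
\<close>

lemma binomial_integral:
  fixes x y :: real
  shows "(\<Sum>l\<le>k. (real (k choose l) * x ^ (k - l)) * (y ^ Suc l / real (Suc l))) =
     ((x + y) ^ Suc k - x ^ Suc k) / real (Suc k)"
proof -
  have "(y + x) ^ Suc k = (\<Sum>l\<le>Suc k. real (Suc k choose l) * y ^ l * x ^ (Suc k - l))"
    by (rule binomial_ring)
  also have "\<dots> = x ^ Suc k + (\<Sum>l\<le>k. real (Suc k choose Suc l) * y ^ Suc l * x ^ (k - l))"
    by (subst sum.atMost_Suc_shift) simp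
  finally have "(x + y) ^ Suc k - x ^ Suc k = (\<Sum>l\<le>k. real (Suc k choose Suc l) * y ^ Suc l * x ^ (k - l))"
    by (simp add: add.commute)
  moreover have "real (Suc k choose Suc l) = real (Suc k) * real (k choose l) / real (Suc l)" for l
  proof -
    have "real (Suc l) * real (Suc k choose Suc l) = real (Suc k) * real (k choose l)"
      by (metis Suc_times_binomial of_nat_mult)
    then show ?thesis by (simp add: field_simps)
  qed
  ultimately show ?thesis
    by (simp add: sum_divide_distrib field_simps del: power_Suc of_nat_Suc binomial_Suc_Suc)
qed

lemma annihilated_shifted:
  assumes "annihilated s A b r v" "m < r"
  shows "(\<Sum>j<s. b j * (x + c j) ^ m * v j) = 0"
    and "annihilated s A b (r - Suc m) (\<lambda>i. \<Sum>j<s. A i j * (x + c j) ^ m * v j)"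
proof -
  show "(\<Sum>j<s. b j * (x + c j) ^ m * v j) = 0"
    unfolding shifted_power
    using annihilated_weight[OF assms(1)] assms(2) by (simp add: sum.neutral)
  show "annihilated s A b (r - Suc m) (\<lambda>i. \<Sum>j<s. A i j * (x + c j) ^ m * v j)"
    unfolding shifted_power
  proof (rule annihilated_sum)
    fix l assume "l \<in> {..m}"
    then show "annihilated s A b (r - Suc m) (\<lambda>i. \<Sum>j<s. A i j * c j ^ l * v j)"
      using assms by (intro annihilated_mono[OF annihilated_apply[OF assms(1), of l]]) auto
  qed
qed

text \<open>
  The conditions can be checked block by block. The products with \<open>b\<close> vanish in each preceding block, so
  that applying the composed matrix acts on a block like \<open>A\<close>, except for the multiple of the unit
  vector which reuse adds; at that moment at least one power of \<open>h\<close> has been used up, whence \<open>r - 1\<close>.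
\<close>

lemma annihilated_composed:
  assumes "\<And>I. I < n \<Longrightarrow> annihilated s A b r (\<lambda>i. v (I * s + i))"
    and "annihilated s A b (r - 1) unit0"
  shows "annihilated (n * s) comp_A comp_b r v"
  using assms
proof (induction r arbitrary: v rule: less_induct)
  case (less r)
  have weight: "(\<Sum>j<s. b j * (rk_node (n * s) comp_A (I * s + j) ^ m * v (I * s + j))) = 0"
    if "I < n" "m < r" for I m
  proof -
    have "(\<Sum>j<s. b j * (rk_node (n * s) comp_A (I * s + j) ^ m * v (I * s + j))) =
      (\<Sum>j<s. b j * (real I + c j) ^ m * v (I * s + j)) / real n ^ m"
      unfolding sum_divide_distrib using that
      by (intro sum.cong refl) (simp add: composed_node power_divide)
    then show ?thesis
      using annihilated_shifted(1)[OF less.prems(1)] that by simp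
  qed
  show ?case
  proof (rule annihilatedI)
    fix m assume m: "m < r"
    have "(\<Sum>i<n * s. comp_b i * rk_node (n * s) comp_A i ^ m * v i) =
      (\<Sum>I<n. (\<Sum>j<s. b j * (rk_node (n * s) comp_A (I * s + j) ^ m * v (I * s + j))) / real n)"
      unfolding sum_blocks
      by (auto intro!: sum.cong simp: composed_b_def sum_divide_distrib)
    then show "(\<Sum>i<n * s. comp_b i * rk_node (n * s) comp_A i ^ m * v i) = 0"
      using weight m by simp
    define w where "w = (\<lambda>i. \<Sum>j<n * s. comp_A i j * rk_node (n * s) comp_A j ^ m * v j)"
    have "annihilated (n * s) comp_A comp_b (r - Suc m) w"
    proof (rule less.IH)
      show "r - Suc m < r" using m by simp
      show "annihilated s A b (r - Suc m - 1) unit0"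
        using less.prems(2) by (rule annihilated_mono) simp
      fix I assume I: "I < n"
      define X where "X = (if I > 0 then \<Sum>j<s. (A (s - 1) j - b j) *
           (rk_node (n * s) comp_A ((I - 1) * s + j) ^ m * v ((I - 1) * s + j)) else 0)"
      have "w (I * s + i) = 1 / real n ^ Suc m * (\<Sum>j<s. A i j * (real I + c j) ^ m * v (I * s + j))
           + X / real n * unit0 i" if i: "i < s" for i
      proof -
        have *: "(\<Sum>J<I. \<Sum>j<s. b j * (rk_node (n * s) comp_A (J * s + j) ^ m * v (J * s + j))) = 0"
          using weight m I by (intro sum.neutral) auto
        have "w (I * s + i) = (\<Sum>j<n * s. comp_A (I * s + i) j * (rk_node (n * s) comp_A j ^ m * v j))"
          by (simp add: w_def mult.assoc)
        also have "\<dots> = ((\<Sum>j<s. A i j * (rk_node (n * s) comp_A (I * s + j) ^ m * v (I * s + j))) + X * unit0 i) / real n"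
          unfolding composed_apply[OF I i] * by (simp add: X_def)
        also have "(\<Sum>j<s. A i j * (rk_node (n * s) comp_A (I * s + j) ^ m * v (I * s + j))) =
           (\<Sum>j<s. A i j * (real I + c j) ^ m * v (I * s + j)) / real n ^ m"
          unfolding sum_divide_distrib using I
          by (intro sum.cong refl) (simp add: composed_node power_divide)
        finally show ?thesis by (simp add: add_divide_distrib mult.commute)
      qed
      moreover have "annihilated s A b (r - Suc m) (\<lambda>i. 1 / real n ^ Suc m * (\<Sum>j<s. A i j * (real I + c j) ^ m * v (I * s + j))
           + X / real n * unit0 i)"
        using annihilated_mono[OF less.prems(2), of "r - Suc m"] m
        by (intro annihilated_add[OF annihilated_scale[OF annihilated_shifted(2)[OF less.prems(1)[OF I] m]]
            annihilated_scale]) auto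
      ultimately show "annihilated s A b (r - Suc m) (\<lambda>i. w (I * s + i))"
        by (elim annihilated_cong) simp
    qed
    then show "annihilated (n * s) comp_A comp_b (r - Suc m) (\<lambda>i. \<Sum>j<n * s. comp_A i j * rk_node (n * s) comp_A j ^ m * v j)"
      by (simp add: w_def)
  qed
qed

lemma quad_shifted:
  assumes "k < p"
  shows "(\<Sum>j<s. b j * (x + c j) ^ k) = ((x + 1) ^ Suc k - x ^ Suc k) / real (Suc k)"
proof -
  have "(\<Sum>j<s. b j * (x + c j) ^ k) = (\<Sum>l\<le>k. (real (k choose l) * x ^ (k - l)) * (1 ^ Suc l / real (Suc l)))"
    using shifted_power[of b x k "\<lambda>_. 1"] assms by (simp add: quad)
  then show ?thesis by (simp only: binomial_integral)
qed

lemma row_shifted: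
  "(\<Sum>j<s. A i j * (x + c j) ^ k) - ((x + c i) ^ Suc k - x ^ Suc k) / real (Suc k) =
     (\<Sum>l\<le>k. (real (k choose l) * x ^ (k - l)) * defect s A l i)"
  using shifted_power[of "A i" x k "\<lambda>_. 1"]
  unfolding binomial_integral[symmetric]
  by (simp add: defect_def right_diff_distrib sum_subtractf)

lemma composed_quad:
  assumes "k < p" "I \<le> n"
  shows "(\<Sum>J<I. \<Sum>j<s. b j * rk_node (n * s) comp_A (J * s + j) ^ k) = real I ^ Suc k / real (Suc k) / real n ^ k"
proof -
  have "(\<Sum>J<I. \<Sum>j<s. b j * rk_node (n * s) comp_A (J * s + j) ^ k) =
    (\<Sum>J<I. (\<Sum>j<s. b j * (real J + c j) ^ k) / real n ^ k)"
    using assms by (intro sum.cong refl)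
       (simp add: composed_node power_divide sum_divide_distrib)
  also have "\<dots> = (\<Sum>J<I. real (Suc J) ^ Suc k - real J ^ Suc k) / real (Suc k) / real n ^ k"
    using assms by (simp add: quad_shifted sum_divide_distrib add.commute del: power_Suc)
  also have "(\<Sum>J<I. real (Suc J) ^ Suc k - real J ^ Suc k) = real I ^ Suc k"
    by (subst sum_lessThan_telescope) simp
  finally show ?thesis .
qed

text \<open>
  The amount by which the reused stage spoils the defect of the first stage of block \<open>I\<close>, in units of
  the step size of a single step.
\<close>

definition reuse_defect :: "nat \<Rightarrow> nat \<Rightarrow> real" where
  "reuse_defect k I = (if I > 0 then \<Sum>j<s. (A (s - 1) j - b j) * (real (I - 1) + c j) ^ k else 0)"

text \<open>
  The quadrature over the preceding blocks telescopes to the exact integral up to the beginning of block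
  \<open>I\<close>; what remains is the shifted formula of a single step and the effect of the reused stage.
\<close>

lemma composed_defect:
  assumes k: "k < p" and I: "I < n" and i: "i < s"
  shows "defect (n * s) comp_A k (I * s + i) =
    ((\<Sum>l\<le>k. (real (k choose l) * real I ^ (k - l)) * defect s A l i) + reuse_defect k I * unit0 i) / real n ^ Suc k"
proof -
  have aux: "(S / real n ^ k + T / u / real n ^ k + X / real n ^ k) / real n - P / real n ^ Suc k / u =
     (S + T / u + X) / real n ^ Suc k - P / u / real n ^ Suc k" for S T X P u :: real
    by (simp add: add_divide_distrib mult_ac)
  have 1: "(\<Sum>j<s. A i j * rk_node (n * s) comp_A (I * s + j) ^ k) = (\<Sum>j<s. A i j * (real I + c j) ^ k) / real n ^ k"
    using I by (simp add: composed_node power_divide sum_divide_distrib)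
  have 2: "(if i = 0 \<and> I > 0 then \<Sum>j<s. (A (s - 1) j - b j) * rk_node (n * s) comp_A ((I - 1) * s + j) ^ k else 0)
     = reuse_defect k I * unit0 i / real n ^ k"
    using I by (auto simp: composed_node power_divide sum_divide_distrib reuse_defect_def)
  have "defect (n * s) comp_A k (I * s + i) = ((\<Sum>j<s. A i j * (real I + c j) ^ k) + real I ^ Suc k / real (Suc k)
     + reuse_defect k I * unit0 i) / real n ^ Suc k - (real I + c i) ^ Suc k / real (Suc k) / real n ^ Suc k"
    unfolding defect_def composed_apply[OF I i] 1 2 composed_node[OF I i] composed_quad[OF k less_imp_le[OF I]]
    by (simp only: power_divide aux)
  then show ?thesis
    unfolding row_shifted[symmetric] by (simp add: diff_divide_distrib add_divide_distrib)
qed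

lemma reuse_defect_eq_0:
  assumes "k < q"
  shows "reuse_defect k I = 0"
proof -
  have "(\<Sum>j<s. (A (s - 1) j - b j) * c j ^ l) = 0" if "l \<le> k" for l
  proof -
    have "(\<Sum>j<s. A (s - 1) j * c j ^ l) = 1 / real (Suc l)"
      using last_quad[of l] that assms by (simp add: defect_def last_node[unfolded One_nat_def])
    then show ?thesis
      using quad[of l] that assms q by (simp add: left_diff_distrib sum_subtractf)
  qed
  then have "(\<Sum>j<s. (A (s - 1) j - b j) * (x + c j) ^ k) = 0" for x
    using shifted_power[of "\<lambda>j. A (s - 1) j - b j" x k "\<lambda>_. 1"] by (simp add: sum.neutral)
  then show ?thesis by (simp add: reuse_defect_def)
qed

lemma annihilated_defect: "annihilated s A b (p - Suc k) (defect s A k)"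
  using cond by (simp add: rk_conditions_def)

lemma explicit_composed: "explicit_rk (n * s) comp_A"
  unfolding explicit_rk_def
proof (intro allI impI)
  fix i j assume ij: "i < n * s" "j < n * s" "i \<le> j"
  have le: "i div s \<le> j div s" using ij by (simp add: div_le_mono)
  have "A (i mod s) (j mod s) = 0" if eq: "j div s = i div s"
  proof -
    have "i mod s \<le> j mod s"
      using ij(3) eq by (metis add_le_cancel_left mult_div_mod_eq)
    then show ?thesis
      using cond s by (simp add: rk_conditions_def explicit_rk_def)
  qed
  then show "comp_A i j = 0" using le by (auto simp: composed_A_def)
qed

theorem rk_conditions_composed: "rk_conditions p (n * s) comp_A comp_b"
  unfolding rk_conditions_def
proof (intro conjI allI impI)
  show "explicit_rk (n * s) comp_A" by (rule explicit_composed)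
  fix k assume k: "k < p"
  have "(\<Sum>i<n * s. comp_b i * rk_node (n * s) comp_A i ^ k) =
     (\<Sum>J<n. \<Sum>j<s. b j * rk_node (n * s) comp_A (J * s + j) ^ k) / real n"
    unfolding sum_blocks
    by (auto intro!: sum.cong simp: composed_b_def sum_divide_distrib)
  also have "\<dots> = 1 / real (Suc k)"
    unfolding composed_quad[OF k order_refl] using n by simp
  finally show "(\<Sum>i<n * s. comp_b i * rk_node (n * s) comp_A i ^ k) = 1 / real (Suc k)" .
next
  fix k
  show "annihilated (n * s) comp_A comp_b (p - Suc k) (defect (n * s) comp_A k)"
  proof (cases "k < p")
    case k: True
    show ?thesis
    proof (cases k)
      case 0
      then show ?thesis
        by (intro annihilated_cong[OF annihilated_zero]) (simp add: defect_def rk_node_def)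
    next
      case (Suc k')
      show ?thesis
      proof (rule annihilated_composed)
        show "annihilated s A b (p - Suc k - 1) unit0"
          using q Suc by (intro annihilated_mono[OF first_stage]) auto
        fix I assume I: "I < n"
        have "annihilated s A b (p - Suc k) (\<lambda>i. 1 / real n ^ Suc k *
          ((\<Sum>l\<le>k. (real (k choose l) * real I ^ (k - l)) * defect s A l i) + reuse_defect k I * unit0 i))"
        proof (rule annihilated_scale[OF annihilated_add[OF annihilated_sum]])
          fix l assume "l \<in> {..k}"
          then show "annihilated s A b (p - Suc k) (defect s A l)"
            by (intro annihilated_mono[OF annihilated_defect[of l]]) auto
        next
          show "annihilated s A b (p - Suc k) (\<lambda>i. reuse_defect k I * unit0 i)"
          proof (cases "k < q")
            case True
            then show ?thesis by (simp add: reuse_defect_eq_0 annihilated_zero)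
          next
            case False
            then show ?thesis
              by (intro annihilated_scale annihilated_mono[OF first_stage]) auto
          qed
        qed
        then show "annihilated s A b (p - Suc k) (\<lambda>i. defect (n * s) comp_A k (I * s + i))"
          by (rule annihilated_cong) (simp add: composed_defect[OF k I] del: power_Suc)
      qed
    qed
  qed simp
next
  show "p \<le> 4 \<or> p = 5 \<and> (\<forall>i<n * s. comp_b i * defect (n * s) comp_A 1 i = 0)"
  proof (cases "p \<le> 4")
    case False
    then have p5: "p = 5" and *: "\<forall>i<s. b i * defect s A 1 i = 0" and q2: "q = 2"
      using cond q by (auto simp: rk_conditions_def)
    have "comp_b i * defect (n * s) comp_A 1 i = 0" if i: "i < n * s" for i
    proof -
      have "i div s < n" "i mod s < s" using i s by (auto simp: less_mult_imp_div_less)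
      then have "defect (n * s) comp_A 1 (i div s * s + i mod s) = defect s A 1 (i mod s) / real n ^ 2"
        using composed_defect[of 1 "i div s" "i mod s"] reuse_defect_eq_0[of 1] p5 q2
        by (simp add: defect_0 power2_eq_square)
      then show ?thesis
        using * \<open>i mod s < s\<close> by (auto simp: composed_b_def)
    qed
    then show ?thesis using p5 by blast
  qed simp
qed

end

section \<open>Asymptotic expansions at zero\<close>

text \<open>
  The filter \<open>nhds 0\<close> instead of \<open>at 0\<close> includes the point \<open>h = 0\<close>; then \<open>h\<close> may be replaced by \<open>a * h\<close> even
  for \<open>a = 0\<close>, which is necessary for stages with node \<open>0\<close>.
\<close>

definition expands :: "nat \<Rightarrow> (real \<Rightarrow> real) \<Rightarrow> (nat \<Rightarrow> real) \<Rightarrow> bool" where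
  "expands N G c \<longleftrightarrow> (\<lambda>h. G h - (\<Sum>k<N. c k * h ^ k)) \<in> O[nhds 0](\<lambda>h. h ^ N)"

lemma power_bigo_power:
  assumes "N \<le> M"
  shows "(\<lambda>h::real. h ^ M) \<in> O[nhds 0](\<lambda>h. h ^ N)"
proof (rule bigoI[of _ 1])
  have "\<forall>\<^sub>F h in nhds (0::real). \<bar>h\<bar> < 1"
    unfolding eventually_nhds_metric by (intro exI[of _ 1]) (simp add: dist_real_def)
  then show "\<forall>\<^sub>F h in nhds (0::real). norm (h ^ M) \<le> 1 * norm (h ^ N)"
  proof eventually_elim
    case (elim h)
    then show ?case using power_decreasing[OF assms, of "\<bar>h\<bar>"] by (simp add: power_abs)
  qed
qed

lemma bigo_power_mono:
  assumes "G \<in> O[nhds 0](\<lambda>h::real. h ^ M)" "N \<le> M"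
  shows "G \<in> O[nhds 0](\<lambda>h. h ^ N)"
  by (rule landau_o.big_trans[OF assms(1) power_bigo_power[OF assms(2)]])

lemma bigo_power_mult:
  assumes "F \<in> O[nhds 0](\<lambda>h::real. h ^ M)" "G \<in> O[nhds 0](\<lambda>h. h ^ N)"
  shows "(\<lambda>h. F h * G h :: real) \<in> O[nhds 0](\<lambda>h. h ^ (M + N))"
  using landau_o.big.mult[OF assms] by (simp add: power_add)

lemma monomial_bigo:
  assumes "N \<le> M"
  shows "(\<lambda>h::real. a * h ^ M) \<in> O[nhds 0](\<lambda>h. h ^ N)"
  by (cases "a = 0") (simp_all add: power_bigo_power[OF assms])

lemma expands_cong:
  assumes "expands N G c" "\<And>k. k < N \<Longrightarrow> c k = d k"
  shows "expands N G d"
proof -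
  have "(\<Sum>k<N. d k * h ^ k) = (\<Sum>k<N. c k * h ^ k)" for h :: real
    using assms(2) by (intro sum.cong) simp_all
  then show ?thesis using assms(1) by (simp add: expands_def)
qed

lemma expands_zero_coeffs:
  assumes "expands N G c" "\<And>k. k < N \<Longrightarrow> c k = 0"
  shows "G \<in> O[nhds 0](\<lambda>h. h ^ N)"
  using assms by (simp add: expands_def)

lemma bigo_expands: "G \<in> O[nhds 0](\<lambda>h. h ^ N) \<Longrightarrow> expands N G (\<lambda>_. 0)"
  by (simp add: expands_def)

lemma expands_mono:
  assumes "expands N G c" "M \<le> N"
  shows "expands M G c"
proof -
  have "(\<lambda>h. \<Sum>k\<in>{M..<N}. c k * h ^ k) \<in> O[nhds 0](\<lambda>h. h ^ M)"
  proof (rule big_sum_in_bigo)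
    fix k assume "k \<in> {M..<N}"
    then show "(\<lambda>h. c k * h ^ k) \<in> O[nhds 0](\<lambda>h. h ^ M)"
      by (intro monomial_bigo) simp
  qed
  moreover have "(\<lambda>h. G h - (\<Sum>k<N. c k * h ^ k)) \<in> O[nhds 0](\<lambda>h. h ^ M)"
    using bigo_power_mono[OF assms(1)[unfolded expands_def] assms(2)] .
  ultimately have "(\<lambda>h. (G h - (\<Sum>k<N. c k * h ^ k)) + (\<Sum>k\<in>{M..<N}. c k * h ^ k)) \<in> O[nhds 0](\<lambda>h. h ^ M)"
    by (rule sum_in_bigo(1)[rotated])
  also have "(\<lambda>h. (G h - (\<Sum>k<N. c k * h ^ k)) + (\<Sum>k\<in>{M..<N}. c k * h ^ k)) =
     (\<lambda>h. G h - (\<Sum>k<M. c k * h ^ k))"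
  proof
    fix h
    have "(\<Sum>k<N. c k * h ^ k) = (\<Sum>k<M. c k * h ^ k) + (\<Sum>k\<in>{M..<N}. c k * h ^ k)"
      using sum.atLeastLessThan_concat[of 0 M N "\<lambda>k. c k * h ^ k"] assms(2)
      by (simp add: atLeast0LessThan)
    then show "(G h - (\<Sum>k<N. c k * h ^ k)) + (\<Sum>k\<in>{M..<N}. c k * h ^ k) = G h - (\<Sum>k<M. c k * h ^ k)"
      by simp
  qed
  finally show ?thesis by (simp add: expands_def)
qed

lemma expands_bounded: "expands N G c \<Longrightarrow> G \<in> O[nhds 0](\<lambda>h. h ^ 0)"
  using expands_mono[of N G c 0] by (simp add: expands_def)

lemma expands_add:
  assumes "expands N F c" "expands N G d"
  shows "expands N (\<lambda>h. F h + G h) (\<lambda>k. c k + d k)"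
  using sum_in_bigo(1)[OF assms[unfolded expands_def]]
  by (simp add: expands_def distrib_right sum.distrib algebra_simps)

lemma expands_cmult:
  assumes "expands N F c"
  shows "expands N (\<lambda>h. a * F h) (\<lambda>k. a * c k)"
proof -
  have "(\<lambda>h. a * (F h - (\<Sum>k<N. c k * h ^ k))) \<in> O[nhds 0](\<lambda>h. h ^ N)"
    using assms by (cases "a = 0") (auto simp: expands_def)
  then show ?thesis
    by (simp add: expands_def right_diff_distrib sum_distrib_left mult.assoc)
qed

lemma expands_diff:
  assumes "expands N F c" "expands N G d"
  shows "expands N (\<lambda>h. F h - G h) (\<lambda>k. c k - d k)"
  using expands_add[OF assms(1) expands_cmult[OF assms(2), of "-1"]] by simp

lemma expands_sum:
  assumes "\<And>l. l \<in> L \<Longrightarrow> expands N (F l) (c l)"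
  shows "expands N (\<lambda>h. \<Sum>l\<in>L. F l h) (\<lambda>k. \<Sum>l\<in>L. c l k)"
  using assms
proof (induction L rule: infinite_finite_induct)
  case (insert x L)
  then show ?case
    using expands_add[of N "F x" "c x" "\<lambda>h. \<Sum>l\<in>L. F l h" "\<lambda>k. \<Sum>l\<in>L. c l k"] by simp
qed (simp_all add: expands_def)

lemma expands_add_bigo:
  assumes "expands N F c" "G \<in> O[nhds 0](\<lambda>h. h ^ N)"
  shows "expands N (\<lambda>h. F h + G h) c"
  using expands_add[OF assms(1) bigo_expands[OF assms(2)]] by simp

lemma expands_const: "expands N (\<lambda>_. a) (\<lambda>k. if k = 0 then a else 0)"
proof (cases N)
  case 0
  then show ?thesis by (simp add: expands_def)
next
  case (Suc M)
  have "(\<Sum>k<Suc M. (if k = 0 then a else 0) * h ^ k) = a" for h :: real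
    by (subst sum.lessThan_Suc_shift) simp
  then show ?thesis by (simp add: expands_def Suc)
qed

lemma expands_times_h:
  assumes "expands N F c"
  shows "expands (Suc N) (\<lambda>h. h * F h) (\<lambda>k. case k of 0 \<Rightarrow> 0 | Suc k \<Rightarrow> c k)"
proof -
  have "(\<lambda>h. h ^ 1 * (F h - (\<Sum>k<N. c k * h ^ k))) \<in> O[nhds 0](\<lambda>h. h ^ (1 + N))"
    using assms unfolding expands_def by (intro bigo_power_mult) auto
  also have "(\<lambda>h. h ^ 1 * (F h - (\<Sum>k<N. c k * h ^ k))) =
     (\<lambda>h. h * F h - (\<Sum>k<Suc N. (case k of 0 \<Rightarrow> 0 | Suc k \<Rightarrow> c k) * h ^ k))"
    by (rule ext, subst sum.lessThan_Suc_shift)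
       (simp add: right_diff_distrib sum_distrib_left mult_ac)
  finally show ?thesis by (simp add: expands_def)
qed

lemma filterlim_rescale: "filterlim (\<lambda>h. a * h) (nhds 0) (nhds (0::real))"
  using tendsto_mult_right_zero[of "\<lambda>h. h" "nhds (0::real)" a] filterlim_ident[of "nhds (0::real)"]
  by (simp add: mult.commute)

lemma expands_rescale:
  assumes "expands N F c"
  shows "expands N (\<lambda>h. F (a * h)) (\<lambda>k. a ^ k * c k)"
proof -
  have "(\<lambda>h. F (a * h) - (\<Sum>k<N. c k * (a * h) ^ k)) \<in> O[nhds 0](\<lambda>h. (a * h) ^ N)"
    using assms filterlim_rescale[of a] unfolding expands_def by (rule landau_o.big.compose)
  moreover have "(\<lambda>h. (a * h) ^ N) \<in> O[nhds 0](\<lambda>h. h ^ N)"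
    using monomial_bigo[of N N "a ^ N"] by (simp add: power_mult_distrib)
  ultimately have "(\<lambda>h. F (a * h) - (\<Sum>k<N. c k * (a * h) ^ k)) \<in> O[nhds 0](\<lambda>h. h ^ N)"
    by (rule landau_o.big_trans)
  then show ?thesis
    by (simp add: expands_def power_mult_distrib mult_ac)
qed

text \<open>
  The two truncated series differ from \<open>F\<close> and \<open>G\<close> by \<open>O(h ^ N)\<close>, and their product differs from its own
  truncation by the monomials over a square of exponents minus a triangle.
\<close>

lemma expands_mult:
  assumes F: "expands N F c" and G: "expands N G d"
  shows "expands N (\<lambda>h. F h * G h) (\<lambda>k. \<Sum>a\<le>k. c a * d (k - a))"
proof -
  define P where "P = (\<lambda>h::real. \<Sum>k<N. c k * h ^ k)"
  define Q where "Q = (\<lambda>h::real. \<Sum>k<N. d k * h ^ k)"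
  define T where "T = {(i, j). i + j < N}"
  define U where "U = {..<N} \<times> {..<N} - T"
  have TU: "T \<subseteq> {..<N} \<times> {..<N}" by (auto simp: T_def)
  have FP: "(\<lambda>h. F h - P h) \<in> O[nhds 0](\<lambda>h. h ^ N)" and GQ: "(\<lambda>h. G h - Q h) \<in> O[nhds 0](\<lambda>h. h ^ N)"
    using F G by (simp_all add: expands_def P_def Q_def)
  have "(\<lambda>h. P h) \<in> O[nhds 0](\<lambda>h. h ^ 0)"
    using expands_bounded[of N P c] by (simp add: expands_def P_def)
  from bigo_power_mult[OF this GQ] bigo_power_mult[OF FP expands_bounded[OF G]]
  have 1: "(\<lambda>h. (F h - P h) * G h + P h * (G h - Q h)) \<in> O[nhds 0](\<lambda>h. h ^ N)"
    by (intro sum_in_bigo(1)) simp_all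
  have 2: "(\<lambda>h. \<Sum>(i, j)\<in>U. c i * d j * h ^ (i + j)) \<in> O[nhds 0](\<lambda>h. h ^ N)"
  proof (rule big_sum_in_bigo)
    fix x assume "x \<in> U"
    then show "(\<lambda>h. case x of (i, j) \<Rightarrow> c i * d j * h ^ (i + j)) \<in> O[nhds 0](\<lambda>h. h ^ N)"
      using monomial_bigo[of N "fst x + snd x" "c (fst x) * d (snd x)"]
      by (cases x) (simp add: U_def T_def)
  qed
  have 3: "(F h - P h) * G h + P h * (G h - Q h) + (\<Sum>(i, j)\<in>U. c i * d j * h ^ (i + j)) =
     F h * G h - (\<Sum>k<N. (\<Sum>a\<le>k. c a * d (k - a)) * h ^ k)" for h
  proof -
    have "P h * Q h = (\<Sum>(i, j)\<in>{..<N} \<times> {..<N}. c i * d j * h ^ (i + j))"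
      by (simp add: P_def Q_def sum_product sum.cartesian_product power_add mult_ac)
    also have "\<dots> = (\<Sum>(i, j)\<in>U. c i * d j * h ^ (i + j)) + (\<Sum>(i, j)\<in>T. c i * d j * h ^ (i + j))"
      unfolding U_def by (rule sum.subset_diff[OF TU]) simp
    also have "(\<Sum>(i, j)\<in>T. c i * d j * h ^ (i + j)) = (\<Sum>k<N. \<Sum>a\<le>k. c a * d (k - a) * h ^ (a + (k - a)))"
      unfolding T_def by (rule sum.triangle_reindex)
    also have "\<dots> = (\<Sum>k<N. (\<Sum>a\<le>k. c a * d (k - a)) * h ^ k)"
      by (simp add: sum_distrib_right)
    finally show ?thesis by (simp add: algebra_simps)
  qed
  show ?thesis
    unfolding expands_def 3[symmetric] by (rule sum_in_bigo(1)[OF 1 2])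
qed

lemma mvt_between:
  fixes \<phi> \<phi>' :: "real \<Rightarrow> real"
  assumes "\<And>u. min a b \<le> u \<Longrightarrow> u \<le> max a b \<Longrightarrow> (\<phi> has_real_derivative \<phi>' u) (at u)"
  obtains w where "min a b \<le> w" "w \<le> max a b" "\<phi> b - \<phi> a = (b - a) * \<phi>' w"
proof (cases a b rule: linorder_cases)
  case less
  then obtain w where "a < w" "w < b" "\<phi> b - \<phi> a = (b - a) * \<phi>' w"
    using MVT2[of a b \<phi> \<phi>'] assms by auto
  then show ?thesis using that[of w] less by simp
next
  case equal
  then show ?thesis using that[of a] by simp
next
  case greater
  then obtain w where "b < w" "w < a" "\<phi> a - \<phi> b = (a - b) * \<phi>' w"
    using MVT2[of b a \<phi> \<phi>'] assms by auto
  then show ?thesis using that[of w] greater by (simp add: algebra_simps)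
qed

text \<open>
  The remainder vanishes at \<open>0\<close> and its derivative is \<open>O(h ^ N)\<close>, so that the mean value theorem gains one
  power of \<open>h\<close>.
\<close>

lemma expands_antiderivative:
  assumes der: "\<forall>\<^sub>F h in nhds 0. (G has_real_derivative G' h) (at h)" and G': "expands N G' c"
  shows "expands (Suc N) G (\<lambda>k. case k of 0 \<Rightarrow> G 0 | Suc k \<Rightarrow> c k / real (Suc k))"
proof -
  define R where "R = (\<lambda>h. G h - (\<Sum>k<Suc N. (case k of 0 \<Rightarrow> G 0 | Suc k \<Rightarrow> c k / real (Suc k)) * h ^ k))"
  define R' where "R' = (\<lambda>h. G' h - (\<Sum>k<N. c k * h ^ k))"
  have R: "R h = G h - G 0 - (\<Sum>k<N. c k / real (Suc k) * h ^ Suc k)" for h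
    unfolding R_def by (subst sum.lessThan_Suc_shift) simp
  have R0: "R 0 = 0" by (simp add: R)
  obtain C where C: "C > 0" "\<forall>\<^sub>F h in nhds 0. norm (R' h) \<le> C * norm (h ^ N)"
    using landau_o.bigE[OF G'[unfolded expands_def, folded R'_def]] by blast
  from eventually_conj[OF C(2) der] obtain \<delta> where \<delta>: "\<delta> > 0"
    "\<And>h. \<bar>h\<bar> < \<delta> \<Longrightarrow> \<bar>R' h\<bar> \<le> C * \<bar>h\<bar> ^ N \<and> (G has_real_derivative G' h) (at h)"
    unfolding eventually_nhds_metric by (auto simp: dist_real_def power_abs)
  have derR: "(R has_real_derivative R' h) (at h)" if "\<bar>h\<bar> < \<delta>" for h
  proof -
    have "((\<lambda>h. c k / real (Suc k) * h ^ Suc k) has_real_derivative c k * h ^ k) (at h)" for k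
      using DERIV_cmult[OF DERIV_pow[of "Suc k" h], of "c k / real (Suc k)"] by (simp del: of_nat_Suc)
    then have "((\<lambda>h. G h - G 0 - (\<Sum>k<N. c k / real (Suc k) * h ^ Suc k)) has_real_derivative
        G' h - 0 - (\<Sum>k<N. c k * h ^ k)) (at h)"
      using \<delta>(2)[OF that] by (intro DERIV_diff DERIV_sum DERIV_const) auto
    then show ?thesis by (simp add: R[abs_def] R'_def)
  qed
  have "norm (R h) \<le> C * norm (h ^ Suc N)" if h: "\<bar>h\<bar> < \<delta>" for h
  proof -
    have "(R has_real_derivative R' u) (at u)" if "min 0 h \<le> u" "u \<le> max 0 h" for u
      using that h by (intro derR) (auto simp: min_def max_def split: if_splits)
    then obtain w where w: "min 0 h \<le> w" "w \<le> max 0 h" "R h - R 0 = (h - 0) * R' w"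
      by (rule mvt_between)
    then have wh: "\<bar>w\<bar> \<le> \<bar>h\<bar>" by (auto simp: min_def max_def split: if_splits)
    have "\<bar>R' w\<bar> \<le> C * \<bar>w\<bar> ^ N" using \<delta>(2)[of w] wh h by simp
    also have "\<dots> \<le> C * \<bar>h\<bar> ^ N" using wh C(1) by (intro mult_left_mono power_mono) auto
    finally have "\<bar>h\<bar> * \<bar>R' w\<bar> \<le> \<bar>h\<bar> * (C * \<bar>h\<bar> ^ N)" by (intro mult_left_mono) auto
    then show ?thesis using w(3) R0 by (simp add: abs_mult power_abs mult_ac)
  qed
  then have "\<forall>\<^sub>F h in nhds 0. norm (R h) \<le> C * norm (h ^ Suc N)"
    unfolding eventually_nhds_metric using \<delta>(1) by (auto simp: dist_real_def)
  then have "R \<in> O[nhds 0](\<lambda>h. h ^ Suc N)" by (rule bigoI)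
  then show ?thesis by (simp add: expands_def R_def)
qed

section \<open>Calculus with partial derivatives on phase space\<close>

text \<open>
  Neighbourhoods in the space \<open>Euclidean_space m\<close> of functions that vanish from index \<open>m\<close> on. Cubes are
  convenient because partial derivatives are taken along paths that change one coordinate at a time.
\<close>

definition cube :: "nat \<Rightarrow> real \<times> (nat \<Rightarrow> real) \<Rightarrow> real \<Rightarrow> (real \<times> (nat \<Rightarrow> real)) set" where
  "cube m z \<delta> = {(t, x). \<bar>t - fst z\<bar> < \<delta> \<and> (\<forall>j<m. \<bar>x j - snd z j\<bar> < \<delta>) \<and> (\<forall>j\<ge>m. x j = 0)}"

lemma cube_mono: "\<delta> \<le> \<delta>' \<Longrightarrow> cube m z \<delta> \<subseteq> cube m z \<delta>'"
  by (force simp: cube_def)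

lemma openin_phase_space_iff:
  "openin (prod_topology euclideanreal (Euclidean_space m)) D \<longleftrightarrow>
     (\<exists>T. open T \<and> D = T \<inter> (UNIV \<times> {x. \<forall>i\<ge>m. x i = 0}))"
  by (simp add: Euclidean_space_def euclidean_product_topology prod_topology_subtopology openin_subtopology
      flip: open_openin)

lemma open_contains_cube:
  fixes T :: "(real \<times> (nat \<Rightarrow> real)) set"
  assumes "open T" "z \<in> T" and z: "\<forall>j\<ge>m. snd z j = 0"
  shows "\<exists>\<delta>>0. cube m z \<delta> \<subseteq> T"
proof -
  obtain U V where UV: "open U" "open V" "z \<in> U \<times> V" "U \<times> V \<subseteq> T"
    by (rule open_prod_elim[OF assms(1,2)])
  obtain \<delta>0 where \<delta>0: "\<delta>0 > 0" "\<And>t. \<bar>t - fst z\<bar> < \<delta>0 \<Longrightarrow> t \<in> U"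
  proof -
    have "fst z \<in> U" using UV(3) by (simp add: mem_Times_iff)
    then obtain d where "d > 0" "ball (fst z) d \<subseteq> U"
      using UV(1) by (meson open_contains_ball)
    then show ?thesis using that[of d] by (auto simp: dist_real_def abs_minus_commute subset_iff)
  qed
  have "openin (product_topology (\<lambda>i. euclidean) UNIV) V"
    using UV(2) by (simp add: euclidean_product_topology flip: open_openin)
  then obtain X where X: "snd z \<in> Pi\<^sub>E UNIV X" "\<And>i. openin euclidean (X i)" "Pi\<^sub>E UNIV X \<subseteq> V"
    using product_topology_open_contains_basis[of "\<lambda>i. euclidean" UNIV V "snd z"] UV(3)
    by (auto simp: mem_Times_iff)
  have "\<exists>\<delta>>0. \<forall>j<k. \<forall>u. \<bar>u - snd z j\<bar> < \<delta> \<longrightarrow> u \<in> X j" for k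
  proof (induction k)
    case 0
    show ?case by (intro exI[of _ 1]) simp
  next
    case (Suc k)
    then obtain \<delta> where \<delta>: "\<delta> > 0" "\<forall>j<k. \<forall>u. \<bar>u - snd z j\<bar> < \<delta> \<longrightarrow> u \<in> X j" by blast
    have "open (X k)" "snd z k \<in> X k" using X(1,2) by (auto simp: PiE_iff simp flip: open_openin)
    then obtain \<delta>' where \<delta>': "\<delta>' > 0" "\<And>u. \<bar>u - snd z k\<bar> < \<delta>' \<Longrightarrow> u \<in> X k"
    proof -
      obtain d where "d > 0" "ball (snd z k) d \<subseteq> X k"
        using \<open>open (X k)\<close> \<open>snd z k \<in> X k\<close> by (meson open_contains_ball)
      then show ?thesis using that[of d] by (auto simp: dist_real_def abs_minus_commute subset_iff)
    qed
    show ?case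
      using \<delta> \<delta>' by (intro exI[of _ "min \<delta> \<delta>'"]) (auto simp: less_Suc_eq)
  qed
  from this[of m] obtain \<delta>1 where \<delta>1: "\<delta>1 > 0" "\<And>j u. j < m \<Longrightarrow> \<bar>u - snd z j\<bar> < \<delta>1 \<Longrightarrow> u \<in> X j"
    by auto
  have "cube m z (min \<delta>0 \<delta>1) \<subseteq> T"
  proof
    fix p assume p: "p \<in> cube m z (min \<delta>0 \<delta>1)"
    obtain t x where tx: "p = (t, x)" by (cases p)
    have "x i \<in> X i" for i
    proof (cases "i < m")
      case True
      then show ?thesis using p \<delta>1(2) by (simp add: tx cube_def)
    next
      case False
      then have "x i = snd z i" using p z by (simp add: tx cube_def)
      then show ?thesis using X(1) by (auto simp: PiE_iff)
    qed
    then have "x \<in> V" using X(3) by (auto simp: PiE_iff)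
    moreover have "t \<in> U" using p \<delta>0(2) by (simp add: tx cube_def)
    ultimately show "p \<in> T" using UV(4) by (auto simp: tx)
  qed
  then show ?thesis using \<delta>0(1) \<delta>1(1) by (intro exI[of _ "min \<delta>0 \<delta>1"]) auto
qed

locale phase_domain =
  fixes m :: nat and D :: "(real \<times> (nat \<Rightarrow> real)) set"
  assumes openin_D: "openin (prod_topology euclideanreal (Euclidean_space m)) D"
begin

lemma D_support: "(t, x) \<in> D \<Longrightarrow> j \<ge> m \<Longrightarrow> x j = 0"
  using openin_D by (auto simp: openin_phase_space_iff)

lemma continuous_cube:
  assumes g: "continuous_on D g" and z: "z \<in> D" and e: "e > (0::real)"
  shows "\<exists>\<delta>>0. cube m z \<delta> \<subseteq> D \<and> (\<forall>p\<in>cube m z \<delta>. \<bar>g p - g z\<bar> < e)"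
proof -
  obtain T where T: "open T" "D = T \<inter> (UNIV \<times> {x. \<forall>i\<ge>m. x i = 0})"
    using openin_D by (auto simp: openin_phase_space_iff)
  have "open (ball (g z) e)" "g z \<in> ball (g z) e" using e by auto
  then obtain T' where T': "open T'" "z \<in> T'" "\<And>p. p \<in> D \<Longrightarrow> p \<in> T' \<Longrightarrow> g p \<in> ball (g z) e"
    using g[unfolded continuous_on_topological, rule_format, OF z] by meson
  have "\<exists>\<delta>>0. cube m z \<delta> \<subseteq> T \<inter> T'"
    using T T' z by (intro open_contains_cube) auto
  then obtain \<delta> where \<delta>: "\<delta> > 0" "cube m z \<delta> \<subseteq> T \<inter> T'" by blast
  moreover have sub: "cube m z \<delta> \<subseteq> D"
    using \<delta>(2) by (auto simp: T(2) cube_def)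
  moreover have "\<bar>g p - g z\<bar> < e" if "p \<in> cube m z \<delta>" for p
    using T'(3)[of p] that sub \<delta>(2) by (auto simp: dist_real_def abs_minus_commute)
  ultimately show ?thesis by blast
qed

definition partials where
  "partials g gt gx \<longleftrightarrow>
     (\<forall>(t, x)\<in>D. ((\<lambda>u. g (u, x)) has_real_derivative gt (t, x)) (at t)) \<and>
     (\<forall>j<m. \<forall>(t, x)\<in>D. ((\<lambda>u. g (t, x(j := u))) has_real_derivative gx j (t, x)) (at (x j)))"

lemma Ck_on_continuous: "Ck_on m r D g \<Longrightarrow> continuous_on D g"
  by (cases r) auto

text \<open>
  All partial derivatives are chosen at once, so that they can be used as functions later.
\<close>

lemma Ck_on_partials:
  assumes "Ck_on m (Suc r) D g"
  obtains gt gx where "partials g gt gx" "Ck_on m r D gt" "\<And>j. j < m \<Longrightarrow> Ck_on m r D (gx j)"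
proof -
  obtain gt where gt: "Ck_on m r D gt" "\<forall>(t, x)\<in>D. ((\<lambda>u. g (u, x)) has_real_derivative gt (t, x)) (at t)"
    using assms by auto
  have "\<forall>j. \<exists>g'. j < m \<longrightarrow> Ck_on m r D g' \<and>
        (\<forall>(t, x)\<in>D. ((\<lambda>u. g (t, x(j := u))) has_real_derivative g' (t, x)) (at (x j)))"
    using assms by auto
  from choice[OF this] obtain gx where "\<forall>j. j < m \<longrightarrow> Ck_on m r D (gx j) \<and>
        (\<forall>(t, x)\<in>D. ((\<lambda>u. g (t, x(j := u))) has_real_derivative gx j (t, x)) (at (x j)))" ..
  then show ?thesis using gt that[of gt gx] by (simp add: partials_def)
qed

lemma Ck_on_Suc: "Ck_on m (Suc r) D g \<Longrightarrow> Ck_on m r D g"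
proof (induction r arbitrary: g)
  case (Suc r)
  obtain gt gx where *: "partials g gt gx" "Ck_on m (Suc r) D gt" "\<And>j. j < m \<Longrightarrow> Ck_on m (Suc r) D (gx j)"
    using Ck_on_partials[OF Suc.prems] by blast
  have gt: "Ck_on m r D gt" and gx: "\<And>j. j < m \<Longrightarrow> Ck_on m r D (gx j)"
    using *(2,3) Suc.IH by blast+
  show ?case
    unfolding Ck_on.simps
  proof (intro conjI allI impI)
    show "continuous_on D g" using Ck_on_continuous[OF Suc.prems] .
    show "\<exists>g'. Ck_on m r D g' \<and> (\<forall>(t, x)\<in>D. ((\<lambda>u. g (u, x)) has_real_derivative g' (t, x)) (at t))"
      using gt *(1) by (intro exI[of _ gt]) (simp add: partials_def)
    fix j assume "j < m"
    then show "\<exists>g'. Ck_on m r D g' \<and> (\<forall>(t, x)\<in>D. ((\<lambda>u. g (t, x(j := u))) has_real_derivative g' (t, x)) (at (x j)))"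
      using gx *(1) by (intro exI[of _ "gx j"]) (simp add: partials_def)
  qed
qed simp

lemma Ck_on_mono: "Ck_on m r D g \<Longrightarrow> r' \<le> r \<Longrightarrow> Ck_on m r' D g"
  by (induction r) (auto simp: le_Suc_eq simp del: Ck_on.simps intro: Ck_on_Suc)

lemma cube_between:
  assumes "(t, x) \<in> cube m z \<delta>" "(t', x') \<in> cube m z \<delta>"
    and "min t t' \<le> \<theta>" "\<theta> \<le> max t t'" "\<And>l. min (x l) (x' l) \<le> \<xi> l \<and> \<xi> l \<le> max (x l) (x' l)"
  shows "(\<theta>, \<xi>) \<in> cube m z \<delta>"
proof -
  have *: "\<bar>u - w\<bar> < \<delta>" if "\<bar>a - w\<bar> < \<delta>" "\<bar>b - w\<bar> < \<delta>" "min a b \<le> u" "u \<le> max a b" for a b u w :: real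
    using that by (auto simp: min_def max_def split: if_splits)
  have "\<bar>\<theta> - fst z\<bar> < \<delta>"
    by (rule *[of t "fst z" t']) (use assms in \<open>auto simp: cube_def\<close>)
  moreover have "\<bar>\<xi> j - snd z j\<bar> < \<delta>" if "j < m" for j
    by (rule *[of "x j" "snd z j" "x' j"]) (use assms that in \<open>auto simp: cube_def\<close>)
  moreover have "\<xi> j = 0" if "j \<ge> m" for j
    using assms(1,2) assms(5)[of j] that by (auto simp: cube_def)
  ultimately show ?thesis by (simp add: cube_def)
qed

text \<open>
  Pass from \<open>x\<close> to \<open>x'\<close> by changing one coordinate after the other and then from \<open>t\<close> to \<open>t'\<close>, with the mean
  value theorem on each segment. The intermediate points lie coordinatewise between the end points,
  hence in every cube that contains these.
\<close>

lemma cube_mvt: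
  assumes part: "partials g gt gx" and sub: "cube m z \<delta> \<subseteq> D"
    and p: "(t, x) \<in> cube m z \<delta>" and p': "(t', x') \<in> cube m z \<delta>"
  shows "\<exists>\<theta> \<xi>. min t t' \<le> \<theta> \<and> \<theta> \<le> max t t' \<and>
     (\<forall>j l. min (x l) (x' l) \<le> \<xi> j l \<and> \<xi> j l \<le> max (x l) (x' l)) \<and>
     g (t', x') - g (t, x) = (t' - t) * gt (\<theta>, x') + (\<Sum>j<m. (x' j - x j) * gx j (t, \<xi> j))"
proof -
  define w where "w = (\<lambda>j l. if l < j then x' l else x l)"
  have w_btw: "min (x l) (x' l) \<le> w j l \<and> w j l \<le> max (x l) (x' l)" for j l
    by (simp add: w_def)
  have "x l = x' l" if "l \<ge> m" for l
    using p p' that by (simp add: cube_def)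
  then have wm: "w m = x'" by (auto simp: w_def fun_eq_iff)
  have w0: "w 0 = x" by (simp add: w_def)
  have tx': "(t, x') \<in> cube m z \<delta>"
    by (rule cube_between[OF p p']) auto
  have "\<exists>v. (\<forall>l. min (x l) (x' l) \<le> v l \<and> v l \<le> max (x l) (x' l)) \<and>
      g (t, w (Suc j)) - g (t, w j) = (x' j - x j) * gx j (t, v)" if j: "j < m" for j
  proof -
    have upd: "(w j)(j := x j) = w j" "(w j)(j := x' j) = w (Suc j)"
      by (auto simp: w_def fun_eq_iff less_Suc_eq)
    have btw: "min (x l) (x' l) \<le> ((w j)(j := u)) l \<and> ((w j)(j := u)) l \<le> max (x l) (x' l)"
      if "min (x j) (x' j) \<le> u" "u \<le> max (x j) (x' j)" for u l
      using that w_btw[of l j] by simp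
    have "((\<lambda>u. g (t, (w j)(j := u))) has_real_derivative gx j (t, (w j)(j := u))) (at u)"
      if u: "min (x j) (x' j) \<le> u" "u \<le> max (x j) (x' j)" for u
    proof -
      have "(t, (w j)(j := u)) \<in> cube m z \<delta>"
        by (rule cube_between[OF p p']) (use btw[OF u] in auto)
      then have "(t, (w j)(j := u)) \<in> D" using sub by blast
      then have "((\<lambda>v. g (t, ((w j)(j := u))(j := v))) has_real_derivative gx j (t, (w j)(j := u))) (at (((w j)(j := u)) j))"
        using part j unfolding partials_def by blast
      then show ?thesis by simp
    qed
    then obtain u where u: "min (x j) (x' j) \<le> u" "u \<le> max (x j) (x' j)"
      "g (t, (w j)(j := x' j)) - g (t, (w j)(j := x j)) = (x' j - x j) * gx j (t, (w j)(j := u))"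
      by (rule mvt_between[of "x j" "x' j" "\<lambda>u. g (t, (w j)(j := u))"])
    then show ?thesis
      using btw[OF u(1,2)] upd by (intro exI[of _ "(w j)(j := u)"]) simp
  qed
  then have "\<exists>v. (\<forall>l. min (x l) (x' l) \<le> v l \<and> v l \<le> max (x l) (x' l)) \<and>
      (j < m \<longrightarrow> g (t, w (Suc j)) - g (t, w j) = (x' j - x j) * gx j (t, v))" for j
    by (cases "j < m") (use w_btw in blast)+
  then have "\<forall>j. \<exists>v. (\<forall>l. min (x l) (x' l) \<le> v l \<and> v l \<le> max (x l) (x' l)) \<and>
      (j < m \<longrightarrow> g (t, w (Suc j)) - g (t, w j) = (x' j - x j) * gx j (t, v))" ..
  from choice[OF this] obtain \<xi> where \<xi>: "\<And>j l. min (x l) (x' l) \<le> \<xi> j l \<and> \<xi> j l \<le> max (x l) (x' l)"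
    "\<And>j. j < m \<Longrightarrow> g (t, w (Suc j)) - g (t, w j) = (x' j - x j) * gx j (t, \<xi> j)"
    by auto
  have "((\<lambda>u. g (u, x')) has_real_derivative gt (u, x')) (at u)" if "min t t' \<le> u" "u \<le> max t t'" for u
  proof -
    have "(u, x') \<in> cube m z \<delta>"
      by (rule cube_between[OF p p' that]) auto
    then show ?thesis using sub part unfolding partials_def by blast
  qed
  then obtain \<theta> where \<theta>: "min t t' \<le> \<theta>" "\<theta> \<le> max t t'" "g (t', x') - g (t, x') = (t' - t) * gt (\<theta>, x')"
    by (rule mvt_between[of t t' "\<lambda>u. g (u, x')"])
  have "g (t, x') - g (t, x) = (\<Sum>j<m. g (t, w (Suc j)) - g (t, w j))"
    using sum_lessThan_telescope[of "\<lambda>j. g (t, w j)" m] by (simp add: wm w0)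
  also have "\<dots> = (\<Sum>j<m. (x' j - x j) * gx j (t, \<xi> j))"
    using \<xi>(2) by (intro sum.cong) auto
  finally show ?thesis using \<theta> \<xi>(1) by (intro exI[of _ \<theta>] exI[of _ \<xi>]) auto
qed

text \<open>
  The functions live on a space without norm, so the Frechet derivative is not at hand; instead, the mean
  value formula is divided by \<open>t - t1\<close> and the continuity of the partial derivatives is used.
\<close>

lemma chain_rule:
  assumes part: "partials g gt gx" and cont: "continuous_on D gt" "\<And>j. j < m \<Longrightarrow> continuous_on D (gx j)"
    and dY: "\<And>j. j < m \<Longrightarrow> ((\<lambda>t. Y t j) has_real_derivative Y' j) (at t1)"
    and YD: "\<forall>\<^sub>F t in nhds t1. (t, Y t) \<in> D"
  shows "((\<lambda>t. g (t, Y t)) has_real_derivative gt (t1, Y t1) + (\<Sum>j<m. Y' j * gx j (t1, Y t1))) (at t1)"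
proof -
  define z where "z = (t1, Y t1)"
  have zD: "z \<in> D" using eventually_nhds_x_imp_x[OF YD] by (simp add: z_def)
  have near: "\<forall>\<^sub>F t in at t1. (t, Y t) \<in> cube m z \<delta>" if \<delta>: "\<delta> > 0" for \<delta>
  proof -
    have "\<forall>\<^sub>F t in at t1. \<bar>Y t j - Y t1 j\<bar> < \<delta>" if "j < m" for j
      using DERIV_isCont[OF dY[OF that]] \<delta>
      unfolding isCont_def tendsto_iff by (auto simp: dist_real_def)
    then have "\<forall>\<^sub>F t in at t1. \<forall>j\<in>{..<m}. \<bar>Y t j - Y t1 j\<bar> < \<delta>"
      by (intro eventually_ball_finite) auto
    moreover have "\<forall>\<^sub>F t in at t1. \<bar>t - t1\<bar> < \<delta>"
      using tendsto_ident_at[of t1 UNIV] \<delta> unfolding tendsto_iff by (auto simp: dist_real_def)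
    moreover have "\<forall>\<^sub>F t in at t1. (t, Y t) \<in> D"
      using YD by (rule filter_leD[OF at_within_le_nhds])
    ultimately show ?thesis
      by eventually_elim (auto simp: cube_def z_def intro: D_support)
  qed
  obtain \<delta> where \<delta>: "\<delta> > 0" "cube m z \<delta> \<subseteq> D"
    using continuous_cube[OF cont(1) zD zero_less_one] by blast
  have gz: "g z = g (t1, Y t1)" by (simp add: z_def)
  have zc: "(t1, Y t1) \<in> cube m z \<epsilon>" if "\<epsilon> > 0" for \<epsilon>
    using that zD D_support by (auto simp: cube_def z_def)
  have "\<forall>t. \<exists>\<theta> \<xi>. (t, Y t) \<in> cube m z \<delta> \<longrightarrow>
     min t1 t \<le> \<theta> \<and> \<theta> \<le> max t1 t \<and>
     (\<forall>j l. min (Y t1 l) (Y t l) \<le> \<xi> j l \<and> \<xi> j l \<le> max (Y t1 l) (Y t l)) \<and>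
     g (t, Y t) - g z = (t - t1) * gt (\<theta>, Y t) + (\<Sum>j<m. (Y t j - Y t1 j) * gx j (t1, \<xi> j))"
    unfolding gz using cube_mvt[OF part \<delta>(2) zc[OF \<delta>(1)]] by blast
  from choice[OF this] obtain \<theta> where "\<forall>t. \<exists>\<xi>. (t, Y t) \<in> cube m z \<delta> \<longrightarrow>
     min t1 t \<le> \<theta> t \<and> \<theta> t \<le> max t1 t \<and>
     (\<forall>j l. min (Y t1 l) (Y t l) \<le> \<xi> j l \<and> \<xi> j l \<le> max (Y t1 l) (Y t l)) \<and>
     g (t, Y t) - g z = (t - t1) * gt (\<theta> t, Y t) + (\<Sum>j<m. (Y t j - Y t1 j) * gx j (t1, \<xi> j))" ..
  from choice[OF this] obtain \<xi> where mv: "\<And>t. (t, Y t) \<in> cube m z \<delta> \<Longrightarrow>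
     min t1 t \<le> \<theta> t \<and> \<theta> t \<le> max t1 t \<and>
     (\<forall>j l. min (Y t1 l) (Y t l) \<le> \<xi> t j l \<and> \<xi> t j l \<le> max (Y t1 l) (Y t l)) \<and>
     g (t, Y t) - g z = (t - t1) * gt (\<theta> t, Y t) + (\<Sum>j<m. (Y t j - Y t1 j) * gx j (t1, \<xi> t j))"
    by blast
  have lim_t: "((\<lambda>t. gt (\<theta> t, Y t)) \<longlongrightarrow> gt z) (at t1)"
    unfolding tendsto_iff
  proof (intro allI impI)
    fix e :: real assume "e > 0"
    then obtain \<delta>' where \<delta>': "\<delta>' > 0" "\<And>p. p \<in> cube m z \<delta>' \<Longrightarrow> \<bar>gt p - gt z\<bar> < e"
      using continuous_cube[OF cont(1) zD \<open>e > 0\<close>] by blast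
    show "\<forall>\<^sub>F t in at t1. dist (gt (\<theta> t, Y t)) (gt z) < e"
      using near[OF \<delta>(1)] near[OF \<delta>'(1)]
    proof eventually_elim
      case (elim t)
      have "(\<theta> t, Y t) \<in> cube m z \<delta>'"
        by (rule cube_between[OF zc[OF \<delta>'(1)] elim(2)])
           (use mv[OF elim(1)] in auto)
      then show ?case using \<delta>'(2) by (simp add: dist_real_def)
    qed
  qed
  have lim_x: "((\<lambda>t. gx j (t1, \<xi> t j)) \<longlongrightarrow> gx j z) (at t1)" if j: "j < m" for j
    unfolding tendsto_iff
  proof (intro allI impI)
    fix e :: real assume "e > 0"
    then obtain \<delta>' where \<delta>': "\<delta>' > 0" "\<And>p. p \<in> cube m z \<delta>' \<Longrightarrow> \<bar>gx j p - gx j z\<bar> < e"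
      using continuous_cube[OF cont(2)[OF j] zD \<open>e > 0\<close>] by blast
    show "\<forall>\<^sub>F t in at t1. dist (gx j (t1, \<xi> t j)) (gx j z) < e"
      using near[OF \<delta>(1)] near[OF \<delta>'(1)]
    proof eventually_elim
      case (elim t)
      have "(t1, \<xi> t j) \<in> cube m z \<delta>'"
        by (rule cube_between[of t1 "Y t1" z \<delta>' t "Y t"])
           (use mv[OF elim(1)] elim(2) zc[OF \<delta>'(1)] in \<open>auto simp: z_def\<close>)
      then show ?case using \<delta>'(2) by (simp add: dist_real_def)
    qed
  qed
  have "((\<lambda>t. gt (\<theta> t, Y t) + (\<Sum>j<m. (Y t j - Y t1 j) / (t - t1) * gx j (t1, \<xi> t j))) \<longlongrightarrow>
      gt z + (\<Sum>j<m. Y' j * gx j z)) (at t1)"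
    using dY by (intro tendsto_add tendsto_sum tendsto_mult lim_t lim_x) (auto simp: has_field_derivative_iff)
  moreover have "\<forall>\<^sub>F t in at t1. gt (\<theta> t, Y t) + (\<Sum>j<m. (Y t j - Y t1 j) / (t - t1) * gx j (t1, \<xi> t j)) =
      (g (t, Y t) - g z) / (t - t1)"
    using near[OF \<delta>(1)] eventually_neq_at_within[of t1 t1 UNIV]
  proof eventually_elim
    case (elim t)
    then have "t - t1 \<noteq> 0" by auto
    then show ?case
      using mv[OF elim(1)] by (simp add: add_divide_distrib sum_divide_distrib)
  qed
  ultimately show ?thesis
    unfolding has_field_derivative_iff
    by (fold z_def) (rule Lim_transform_eventually)
qed

lemma cube_lipschitz:
  assumes g: "Ck_on m (Suc 0) D g" and z: "z \<in> D"
  shows "\<exists>\<delta>>0. \<exists>B\<ge>0. \<forall>t x x'. (t, x) \<in> cube m z \<delta> \<longrightarrow> (t, x') \<in> cube m z \<delta> \<longrightarrow>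
     \<bar>g (t, x') - g (t, x)\<bar> \<le> B * (\<Sum>l<m. \<bar>x' l - x l\<bar>)"
proof -
  obtain gt gx where part: "partials g gt gx" and gx: "\<And>j. j < m \<Longrightarrow> Ck_on m 0 D (gx j)"
    using Ck_on_partials[OF g] by blast
  obtain \<delta>0 where \<delta>0: "\<delta>0 > 0" "cube m z \<delta>0 \<subseteq> D"
    using continuous_cube[OF Ck_on_continuous[OF g] z zero_less_one] by blast
  have "\<exists>\<delta>>0. \<delta> \<le> \<delta>0 \<and> (\<exists>B\<ge>0. \<forall>j<k. \<forall>p\<in>cube m z \<delta>. \<bar>gx j p\<bar> \<le> B)" if "k \<le> m" for k
    using that
  proof (induction k)
    case 0
    show ?case using \<delta>0(1) by auto
  next
    case (Suc k)
    then obtain \<delta> B where \<delta>: "\<delta> > 0" "\<delta> \<le> \<delta>0" "B \<ge> 0" "\<forall>j<k. \<forall>p\<in>cube m z \<delta>. \<bar>gx j p\<bar> \<le> B" by auto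
    obtain \<delta>' where \<delta>': "\<delta>' > 0" "\<forall>p\<in>cube m z \<delta>'. \<bar>gx k p - gx k z\<bar> < 1"
      using continuous_cube[OF Ck_on_continuous[OF gx[of k]] z zero_less_one] Suc.prems by (auto simp: Suc_le_eq)
    have "\<bar>gx j p\<bar> \<le> max B (\<bar>gx k z\<bar> + 1)" if "j < Suc k" "p \<in> cube m z (min \<delta> \<delta>')" for j p
    proof (cases "j = k")
      case True
      have "p \<in> cube m z \<delta>'" using that(2) cube_mono[of "min \<delta> \<delta>'" \<delta>' m z] by auto
      then have "\<bar>gx k p - gx k z\<bar> < 1" using \<delta>'(2) by blast
      then show ?thesis unfolding True by linarith
    next
      case False
      have "p \<in> cube m z \<delta>" using that(2) cube_mono[of "min \<delta> \<delta>'" \<delta> m z] by auto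
      then have "\<bar>gx j p\<bar> \<le> B" using \<delta>(4) that(1) False by auto
      then show ?thesis by linarith
    qed
    then show ?case
      using \<delta>(1-3) \<delta>'(1)
      by (intro exI[of _ "min \<delta> \<delta>'"] conjI exI[of _ "max B (\<bar>gx k z\<bar> + 1)"]) auto
  qed
  from this[OF order_refl] obtain \<delta> B where \<delta>: "\<delta> > 0" "\<delta> \<le> \<delta>0" "B \<ge> 0"
    "\<And>j p. j < m \<Longrightarrow> p \<in> cube m z \<delta> \<Longrightarrow> \<bar>gx j p\<bar> \<le> B" by auto
  have sub: "cube m z \<delta> \<subseteq> D" using cube_mono[OF \<delta>(2)] \<delta>0(2) by blast
  have "\<bar>g (t, x') - g (t, x)\<bar> \<le> B * (\<Sum>l<m. \<bar>x' l - x l\<bar>)"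
    if p: "(t, x) \<in> cube m z \<delta>" "(t, x') \<in> cube m z \<delta>" for t x x'
  proof -
    obtain \<theta> \<xi> where \<xi>: "\<And>j l. min (x l) (x' l) \<le> \<xi> j l \<and> \<xi> j l \<le> max (x l) (x' l)"
      "g (t, x') - g (t, x) = (t - t) * gt (\<theta>, x') + (\<Sum>j<m. (x' j - x j) * gx j (t, \<xi> j))"
      using cube_mvt[OF part sub p] by blast
    have "\<bar>g (t, x') - g (t, x)\<bar> \<le> (\<Sum>j<m. \<bar>(x' j - x j) * gx j (t, \<xi> j)\<bar>)"
      using \<xi>(2) by simp
    also have "\<dots> \<le> (\<Sum>j<m. B * \<bar>x' j - x j\<bar>)"
    proof (rule sum_mono)
      fix j assume j: "j \<in> {..<m}"
      have "(t, \<xi> j) \<in> cube m z \<delta>"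
        by (rule cube_between[OF p]) (use \<xi>(1) in auto)
      then have "\<bar>gx j (t, \<xi> j)\<bar> \<le> B" using \<delta>(4) j by auto
      then show "\<bar>(x' j - x j) * gx j (t, \<xi> j)\<bar> \<le> B * \<bar>x' j - x j\<bar>"
        by (subst abs_mult, subst mult.commute) (intro mult_right_mono abs_ge_zero)
    qed
    finally show ?thesis by (simp add: sum_distrib_left)
  qed
  then show ?thesis using \<delta>(1,3) by blast
qed

text \<open>
  In the mean value formula the partial derivatives are taken at intermediate points; moving them to
  \<open>x\<close> costs a second factor of the size of \<open>x' - x\<close>, as they are Lipschitz continuous.
\<close>

lemma cube_linearization:
  assumes g: "Ck_on m (Suc (Suc 0)) D g" and part: "partials g gt gx"
    and gx: "\<And>j. j < m \<Longrightarrow> Ck_on m (Suc 0) D (gx j)" and z: "z \<in> D"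
  shows "\<exists>\<delta>>0. \<exists>B\<ge>0. \<forall>t x x'. (t, x) \<in> cube m z \<delta> \<longrightarrow> (t, x') \<in> cube m z \<delta> \<longrightarrow>
     \<bar>g (t, x') - g (t, x) - (\<Sum>l<m. (x' l - x l) * gx l (t, x))\<bar> \<le> B * (\<Sum>l<m. \<bar>x' l - x l\<bar>) ^ 2"
proof -
  obtain \<delta>0 where \<delta>0: "\<delta>0 > 0" "cube m z \<delta>0 \<subseteq> D"
    using continuous_cube[OF Ck_on_continuous[OF g] z zero_less_one] by blast
  have "\<exists>\<delta>>0. \<delta> \<le> \<delta>0 \<and> (\<exists>B\<ge>0. \<forall>j<k. \<forall>t x x'. (t, x) \<in> cube m z \<delta> \<longrightarrow> (t, x') \<in> cube m z \<delta> \<longrightarrow>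
     \<bar>gx j (t, x') - gx j (t, x)\<bar> \<le> B * (\<Sum>l<m. \<bar>x' l - x l\<bar>))" if "k \<le> m" for k
    using that
  proof (induction k)
    case 0
    show ?case using \<delta>0(1) by auto
  next
    case (Suc k)
    then obtain \<delta> B where \<delta>: "\<delta> > 0" "\<delta> \<le> \<delta>0" "B \<ge> 0"
      "\<And>j t x x'. j < k \<Longrightarrow> (t, x) \<in> cube m z \<delta> \<Longrightarrow> (t, x') \<in> cube m z \<delta> \<Longrightarrow>
         \<bar>gx j (t, x') - gx j (t, x)\<bar> \<le> B * (\<Sum>l<m. \<bar>x' l - x l\<bar>)" by auto
    obtain \<delta>' B' where \<delta>': "\<delta>' > 0" "B' \<ge> 0"
      "\<And>t x x'. (t, x) \<in> cube m z \<delta>' \<Longrightarrow> (t, x') \<in> cube m z \<delta>' \<Longrightarrow>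
         \<bar>gx k (t, x') - gx k (t, x)\<bar> \<le> B' * (\<Sum>l<m. \<bar>x' l - x l\<bar>)"
      using cube_lipschitz[OF gx z, of k] Suc.prems by auto
    have "\<bar>gx j (t, x') - gx j (t, x)\<bar> \<le> max B B' * (\<Sum>l<m. \<bar>x' l - x l\<bar>)"
      if "j < Suc k" "(t, x) \<in> cube m z (min \<delta> \<delta>')" "(t, x') \<in> cube m z (min \<delta> \<delta>')" for j t x x'
    proof -
      have "\<bar>gx j (t, x') - gx j (t, x)\<bar> \<le> (if j = k then B' else B) * (\<Sum>l<m. \<bar>x' l - x l\<bar>)"
        using \<delta>(4)[of j t x x'] \<delta>'(3)[of t x x'] that
          cube_mono[of "min \<delta> \<delta>'" \<delta> m z] cube_mono[of "min \<delta> \<delta>'" \<delta>' m z]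
        by (cases "j = k") (simp_all add: subset_iff less_Suc_eq)
      also have "\<dots> \<le> max B B' * (\<Sum>l<m. \<bar>x' l - x l\<bar>)"
        by (intro mult_right_mono sum_nonneg) auto
      finally show ?thesis .
    qed
    then show ?case
      using \<delta>(1-3) \<delta>'(1) by (intro exI[of _ "min \<delta> \<delta>'"] conjI exI[of _ "max B B'"]) auto
  qed
  from this[OF order_refl] obtain \<delta> B where \<delta>: "\<delta> > 0" "\<delta> \<le> \<delta>0" "B \<ge> 0"
    "\<And>j t x x'. j < m \<Longrightarrow> (t, x) \<in> cube m z \<delta> \<Longrightarrow> (t, x') \<in> cube m z \<delta> \<Longrightarrow>
       \<bar>gx j (t, x') - gx j (t, x)\<bar> \<le> B * (\<Sum>l<m. \<bar>x' l - x l\<bar>)" by auto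
  have sub: "cube m z \<delta> \<subseteq> D" using cube_mono[OF \<delta>(2)] \<delta>0(2) by blast
  have "\<bar>g (t, x') - g (t, x) - (\<Sum>l<m. (x' l - x l) * gx l (t, x))\<bar> \<le> B * (\<Sum>l<m. \<bar>x' l - x l\<bar>) ^ 2"
    if p: "(t, x) \<in> cube m z \<delta>" "(t, x') \<in> cube m z \<delta>" for t x x'
  proof -
    define S where "S = (\<Sum>l<m. \<bar>x' l - x l\<bar>)"
    obtain \<theta> \<xi> where \<xi>: "\<And>j l. min (x l) (x' l) \<le> \<xi> j l \<and> \<xi> j l \<le> max (x l) (x' l)"
      "g (t, x') - g (t, x) = (t - t) * gt (\<theta>, x') + (\<Sum>j<m. (x' j - x j) * gx j (t, \<xi> j))"
      using cube_mvt[OF part sub p] by blast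
    have "g (t, x') - g (t, x) - (\<Sum>l<m. (x' l - x l) * gx l (t, x)) =
       (\<Sum>j<m. (x' j - x j) * (gx j (t, \<xi> j) - gx j (t, x)))"
      using \<xi>(2) by (simp add: right_diff_distrib sum_subtractf)
    also have "\<bar>\<dots>\<bar> \<le> (\<Sum>j<m. \<bar>(x' j - x j) * (gx j (t, \<xi> j) - gx j (t, x))\<bar>)"
      by (rule sum_abs)
    also have "\<dots> \<le> (\<Sum>j<m. \<bar>x' j - x j\<bar> * (B * S))"
    proof (rule sum_mono)
      fix j assume j: "j \<in> {..<m}"
      have "(t, \<xi> j) \<in> cube m z \<delta>"
        by (rule cube_between[OF p]) (use \<xi>(1) in auto)
      then have "\<bar>gx j (t, \<xi> j) - gx j (t, x)\<bar> \<le> B * (\<Sum>l<m. \<bar>\<xi> j l - x l\<bar>)"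
        using \<delta>(4) j p(1) by auto
      also have "\<dots> \<le> B * S"
      proof -
        have "\<bar>\<xi> j l - x l\<bar> \<le> \<bar>x' l - x l\<bar>" for l
          using \<xi>(1)[of l j] by (auto simp: min_def max_def split: if_splits)
        then show ?thesis
          unfolding S_def using \<delta>(3) by (intro mult_left_mono sum_mono) auto
      qed
      finally show "\<bar>(x' j - x j) * (gx j (t, \<xi> j) - gx j (t, x))\<bar> \<le> \<bar>x' j - x j\<bar> * (B * S)"
        unfolding abs_mult by (intro mult_left_mono) auto
    qed
    also have "\<dots> = B * S ^ 2"
      by (simp add: S_def sum_distrib_right[symmetric] power2_eq_square)
    finally show ?thesis by (simp add: S_def)
  qed
  then show ?thesis using \<delta>(1,3) by blast
qed

end

section \<open>Expansions along a solution\<close>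

lemma bigo_power_small:
  assumes "G \<in> O[nhds 0](\<lambda>h::real. h ^ M)" "1 \<le> M" "(e::real) > 0"
  shows "\<forall>\<^sub>F h in nhds 0. \<bar>G h :: real\<bar> < e"
proof -
  have "G \<in> O[nhds 0](\<lambda>h. h ^ 1)" using bigo_power_mono[OF assms(1,2)] .
  then obtain C where C: "C > 0" "\<forall>\<^sub>F h in nhds 0. norm (G h) \<le> C * norm (h ^ 1)"
    using landau_o.bigE by blast
  have "\<forall>\<^sub>F h in nhds (0::real). \<bar>h\<bar> < e / C"
    unfolding eventually_nhds_metric using C(1) assms(3) by (intro exI[of _ "e / C"]) (simp add: dist_real_def)
  with C(2) show ?thesis
  proof eventually_elim
    case (elim h)
    then have "C * \<bar>h\<bar> < e" using C(1) by (simp add: field_simps)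
    then show ?case using elim(1) by simp
  qed
qed

lemma eventually_rescale:
  assumes "\<forall>\<^sub>F h in nhds (0::real). P h"
  shows "\<forall>\<^sub>F h in nhds 0. P (a * h)"
  using assms filterlim_rescale by (rule eventually_compose_filterlim)

text \<open>
  Class \<open>C\<^sup>6\<close> suffices for all orders up to five: the Jacobian is then expanded with remainder \<open>O(h\<^sup>5)\<close>, the
  slope with remainder \<open>O(h\<^sup>6)\<close> and the solution with remainder \<open>O(h\<^sup>7)\<close>.
\<close>

locale ivp = phase_domain m D for m D +
  fixes f :: "real \<Rightarrow> (nat \<Rightarrow> real) \<Rightarrow> nat \<Rightarrow> real" and y :: "real \<Rightarrow> nat \<Rightarrow> real" and t0 \<epsilon> :: real
  assumes sys: "Ck_system m 6 D f" and eps: "\<epsilon> > 0" and sol: "solves_system m D f y {t0 - \<epsilon><..<t0 + \<epsilon>}"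
begin

abbreviation "z0 \<equiv> (t0, y t0)"
abbreviation "slope \<kappa> h \<equiv> f (t0 + h) (y (t0 + h)) \<kappa>"

lemma f_Ck: "\<kappa> < m \<Longrightarrow> Ck_on m 6 D (\<lambda>(t, x). f t x \<kappa>)"
  using sys by (auto simp: Ck_system_def)

lemma f_support: "(t, x) \<in> D \<Longrightarrow> k \<ge> m \<Longrightarrow> f t x k = 0"
  using sys by (auto simp: Ck_system_def topspace_Euclidean_space)

lemma sol_D: "\<bar>h\<bar> < \<epsilon> \<Longrightarrow> (t0 + h, y (t0 + h)) \<in> D"
  using sol[unfolded solves_system_def, rule_format, of "t0 + h"] by (auto simp: abs_less_iff)

lemma sol_deriv: "\<bar>h\<bar> < \<epsilon> \<Longrightarrow> \<kappa> < m \<Longrightarrow> ((\<lambda>t. y t \<kappa>) has_real_derivative slope \<kappa> h) (at (t0 + h))"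
  using sol[unfolded solves_system_def, rule_format, of "t0 + h"] by (auto simp: abs_less_iff)

lemma z0_D: "z0 \<in> D"
  using sol_D[of 0] eps by simp

lemma near_0: "\<forall>\<^sub>F h in nhds 0. \<bar>h\<bar> < \<epsilon>"
  unfolding eventually_nhds_metric using eps by (intro exI[of _ \<epsilon>]) (simp add: dist_real_def)

lemma sol_near:
  assumes "\<delta> > 0"
  shows "\<forall>\<^sub>F h in nhds 0. (t0 + h, y (t0 + h)) \<in> cube m z0 \<delta>"
proof -
  have "\<forall>\<^sub>F h in nhds 0. \<bar>y (t0 + h) j - y t0 j\<bar> < \<delta>" if "j < m" for j
  proof -
    have "isCont (\<lambda>t. y t j) t0"
      using DERIV_isCont[OF sol_deriv[of 0 j]] eps that by simp
    then have "((\<lambda>h. y (t0 + h) j) \<longlongrightarrow> y t0 j) (at 0)"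
      by (simp add: isCont_iff)
    then have "\<forall>\<^sub>F h in at 0. dist (y (t0 + h) j) (y t0 j) < \<delta>"
      using assms unfolding tendsto_iff by blast
    then have "\<forall>\<^sub>F h in nhds 0. h \<noteq> 0 \<longrightarrow> \<bar>y (t0 + h) j - y t0 j\<bar> < \<delta>"
      by (simp add: eventually_at_filter dist_real_def)
    then show ?thesis
      by eventually_elim (use assms in auto)
  qed
  then have "\<forall>\<^sub>F h in nhds 0. \<forall>j\<in>{..<m}. \<bar>y (t0 + h) j - y t0 j\<bar> < \<delta>"
    by (intro eventually_ball_finite) auto
  moreover have "\<forall>\<^sub>F h in nhds (0::real). \<bar>h\<bar> < \<delta>"
    unfolding eventually_nhds_metric using assms by (intro exI[of _ \<delta>]) (simp add: dist_real_def)
  ultimately show ?thesis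
    using near_0 by eventually_elim (auto simp: cube_def intro: D_support[OF sol_D])
qed

text \<open>
  By the chain rule, the derivative of \<open>g\<close> along the solution is again a combination of functions along
  the solution, of one class less; the expansion of the derivative is then integrated. No higher
  derivatives of the solution have to be formed.
\<close>

lemma expands_along_solution:
  assumes "Ck_on m N D g" "N \<le> 6"
  shows "\<exists>c. expands N (\<lambda>h. g (t0 + h, y (t0 + h))) c"
  using assms
proof (induction N arbitrary: g)
  case 0
  obtain \<delta> where \<delta>: "\<delta> > 0" "\<forall>p\<in>cube m z0 \<delta>. \<bar>g p - g z0\<bar> < 1"
    using continuous_cube[OF Ck_on_continuous[OF 0(1)] z0_D zero_less_one] by blast
  have "(\<lambda>h. g (t0 + h, y (t0 + h))) \<in> O[nhds 0](\<lambda>h. h ^ 0)"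
  proof (rule bigoI[of _ "\<bar>g z0\<bar> + 1"])
    show "\<forall>\<^sub>F h in nhds 0. norm (g (t0 + h, y (t0 + h))) \<le> (\<bar>g z0\<bar> + 1) * norm (h ^ 0)"
      using sol_near[OF \<delta>(1)]
    proof eventually_elim
      case (elim h)
      then have "\<bar>g (t0 + h, y (t0 + h)) - g z0\<bar> < 1" using \<delta>(2) by blast
      then show ?case by simp
    qed
  qed
  then show ?case by (auto simp: expands_def)
next
  case (Suc N)
  obtain gt gx where part: "partials g gt gx" and gt: "Ck_on m N D gt" and gx: "\<And>j. j < m \<Longrightarrow> Ck_on m N D (gx j)"
    using Ck_on_partials[OF Suc.prems(1)] by blast
  obtain ct where ct: "expands N (\<lambda>h. gt (t0 + h, y (t0 + h))) ct"
    using Suc.IH[OF gt] Suc.prems(2) by auto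
  have "\<exists>c. expands N (\<lambda>h. slope j h * gx j (t0 + h, y (t0 + h))) c" if j: "j < m" for j
  proof -
    have "Ck_on m N D (\<lambda>(t, x). f t x j)"
      using Ck_on_mono[OF f_Ck[OF j]] Suc.prems(2) by simp
    then obtain c where "expands N (\<lambda>h. slope j h) c"
      using Suc.IH Suc.prems(2) by fastforce
    moreover obtain d where "expands N (\<lambda>h. gx j (t0 + h, y (t0 + h))) d"
      using Suc.IH[OF gx[OF j]] Suc.prems(2) by auto
    ultimately show ?thesis using expands_mult by blast
  qed
  then have "\<forall>j. \<exists>c. j < m \<longrightarrow> expands N (\<lambda>h. slope j h * gx j (t0 + h, y (t0 + h))) c" by blast
  from choice[OF this] obtain cx where
    cx: "\<And>j. j < m \<Longrightarrow> expands N (\<lambda>h. slope j h * gx j (t0 + h, y (t0 + h))) (cx j)" by blast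
  define G' where "G' = (\<lambda>h. gt (t0 + h, y (t0 + h)) + (\<Sum>j<m. slope j h * gx j (t0 + h, y (t0 + h))))"
  have "expands N G' (\<lambda>k. ct k + (\<Sum>j<m. cx j k))"
    unfolding G'_def using cx by (intro expands_add ct expands_sum) auto
  moreover have "\<forall>\<^sub>F h in nhds 0. ((\<lambda>h. g (t0 + h, y (t0 + h))) has_real_derivative G' h) (at h)"
    using near_0
  proof eventually_elim
    case (elim h)
    have "\<forall>\<^sub>F t in nhds (t0 + h). t \<in> {t0 - \<epsilon><..<t0 + \<epsilon>}"
      using elim by (intro eventually_nhds_in_open) auto
    then have "\<forall>\<^sub>F t in nhds (t0 + h). (t, y t) \<in> D"
      by eventually_elim (use sol in \<open>auto simp: solves_system_def\<close>)
    then have "((\<lambda>t. g (t, y t)) has_real_derivative G' h) (at (t0 + h))"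
      unfolding G'_def
      by (intro chain_rule[OF part] Ck_on_continuous[OF gt] Ck_on_continuous[OF gx] sol_deriv[OF elim]) auto
    then show ?case
      using DERIV_shift[of "\<lambda>t. g (t, y t)" "G' h" h t0] by (simp add: add.commute)
  qed
  ultimately show ?case using expands_antiderivative by blast
qed

lemma perturbed_near:
  assumes X: "\<And>l. l < m \<Longrightarrow> (\<lambda>h. X h l - y (t0 + a * h) l) \<in> O[nhds 0](\<lambda>h. h ^ M)" and M: "1 \<le> M"
    and supp: "\<forall>\<^sub>F h in nhds 0. \<forall>k\<ge>m. X h k = 0" and \<delta>: "\<delta> > 0"
  shows "\<forall>\<^sub>F h in nhds 0. (t0 + a * h, X h) \<in> cube m z0 \<delta>"
proof -
  have "\<forall>\<^sub>F h in nhds 0. \<forall>l\<in>{..<m}. \<bar>X h l - y (t0 + a * h) l\<bar> < \<delta> / 2"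
    using bigo_power_small[OF X M half_gt_zero[OF \<delta>]] by (intro eventually_ball_finite) simp_all
  moreover have "\<forall>\<^sub>F h in nhds 0. (t0 + a * h, y (t0 + a * h)) \<in> cube m z0 (\<delta> / 2)"
    using eventually_rescale[OF sol_near[of "\<delta> / 2"]] \<delta> by simp
  ultimately show ?thesis
    using supp
  proof eventually_elim
    case (elim h)
    have "\<bar>X h l - y t0 l\<bar> < \<delta>" if "l < m" for l
    proof -
      have "\<bar>X h l - y (t0 + a * h) l\<bar> < \<delta> / 2" "\<bar>y (t0 + a * h) l - y t0 l\<bar> < \<delta> / 2"
        using elim that by (auto simp: cube_def)
      then show ?thesis by linarith
    qed
    then show ?case using elim \<delta> by (simp add: cube_def)
  qed
qed

text \<open>
  How a slope reacts to a perturbation of size \<open>O(h ^ M)\<close> of the solution: by the Jacobian along the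
  solution, with Taylor coefficients \<open>jc\<close>, and up to \<open>O(h ^ (2 * M))\<close>, as far as the fifth power. It matters that \<open>jc\<close> depends neither on
  the node \<open>a\<close> nor on the perturbation.
\<close>

lemma perturbation:
  assumes \<kappa>: "\<kappa> < m"
  shows "\<exists>jc. \<forall>a X M N c. 1 \<le> M \<longrightarrow> N \<le> 2 * M \<longrightarrow> N \<le> 5 \<longrightarrow>
     (\<forall>\<^sub>F h in nhds 0. \<forall>k\<ge>m. X h k = 0) \<longrightarrow>
     (\<forall>l<m. (\<lambda>h. X h l - y (t0 + a * h) l) \<in> O[nhds 0](\<lambda>h. h ^ M)) \<longrightarrow>
     (\<forall>l<m. expands N (\<lambda>h. X h l - y (t0 + a * h) l) (c l)) \<longrightarrow>
     expands N (\<lambda>h. f (t0 + a * h) (X h) \<kappa> - slope \<kappa> (a * h))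
       (\<lambda>k. \<Sum>l<m. \<Sum>i\<le>k. a ^ i * jc l i * c l (k - i))"
proof -
  define g where "g = (\<lambda>(t, x). f t x \<kappa>)"
  have g6: "Ck_on m (Suc 5) D g" using f_Ck[OF \<kappa>] by (simp add: g_def numeral_eq_Suc)
  obtain gt gx where part: "partials g gt gx" and gx: "\<And>j. j < m \<Longrightarrow> Ck_on m 5 D (gx j)"
    using Ck_on_partials[OF g6] by blast
  have "\<forall>l. \<exists>c. l < m \<longrightarrow> expands 5 (\<lambda>h. gx l (t0 + h, y (t0 + h))) c"
    using expands_along_solution[OF gx] by auto
  from choice[OF this] obtain jc where
    jc: "\<And>l. l < m \<Longrightarrow> expands 5 (\<lambda>h. gx l (t0 + h, y (t0 + h))) (jc l)" by blast
  have "\<exists>\<delta>>0. \<exists>B\<ge>0. \<forall>t x x'. (t, x) \<in> cube m z0 \<delta> \<longrightarrow> (t, x') \<in> cube m z0 \<delta> \<longrightarrow>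
     \<bar>g (t, x') - g (t, x) - (\<Sum>l<m. (x' l - x l) * gx l (t, x))\<bar> \<le> B * (\<Sum>l<m. \<bar>x' l - x l\<bar>) ^ 2"
    using Ck_on_mono[OF g6] Ck_on_mono[OF gx] by (intro cube_linearization[OF _ part _ z0_D]) (simp_all del: Ck_on.simps)
  then obtain \<delta> B where \<delta>: "\<delta> > 0" "B \<ge> 0"
    and lin: "\<And>t x x'. (t, x) \<in> cube m z0 \<delta> \<Longrightarrow> (t, x') \<in> cube m z0 \<delta> \<Longrightarrow>
     \<bar>g (t, x') - g (t, x) - (\<Sum>l<m. (x' l - x l) * gx l (t, x))\<bar> \<le> B * (\<Sum>l<m. \<bar>x' l - x l\<bar>) ^ 2"
    by blast
  show ?thesis
  proof (intro exI[of _ jc] allI impI)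
    fix a X M N c
    assume M: "1 \<le> M" and N: "N \<le> 2 * M" "N \<le> 5"
      and supp: "\<forall>\<^sub>F h in nhds 0. \<forall>k\<ge>m. X h k = 0"
      and XM: "\<forall>l<m. (\<lambda>h. X h l - y (t0 + a * h) l) \<in> O[nhds 0](\<lambda>h. h ^ M)"
      and Xc: "\<forall>l<m. expands N (\<lambda>h. X h l - y (t0 + a * h) l) (c l)"
    define e where "e = (\<lambda>l h. X h l - y (t0 + a * h) l)"
    define J where "J = (\<lambda>l h. gx l (t0 + a * h, y (t0 + a * h)))"
    define S where "S = (\<lambda>h. \<Sum>l<m. \<bar>e l h\<bar>)"
    define \<rho> where "\<rho> = (\<lambda>h. f (t0 + a * h) (X h) \<kappa> - slope \<kappa> (a * h) - (\<Sum>l<m. J l h * e l h))"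
    have "\<forall>\<^sub>F h in nhds 0. (t0 + a * h, y (t0 + a * h)) \<in> cube m z0 \<delta>"
      using eventually_rescale[OF sol_near[OF \<delta>(1)]] by simp
    moreover have "\<forall>\<^sub>F h in nhds 0. (t0 + a * h, X h) \<in> cube m z0 \<delta>"
      using XM M supp \<delta>(1) by (intro perturbed_near[of X a M]) auto
    ultimately have \<rho>_bound: "\<forall>\<^sub>F h in nhds 0. norm (\<rho> h) \<le> B * norm (S h * S h)"
    proof eventually_elim
      case (elim h)
      then have "\<bar>g (t0 + a * h, X h) - g (t0 + a * h, y (t0 + a * h)) - (\<Sum>l<m. e l h * J l h)\<bar> \<le> B * (S h) ^ 2"
        using lin[OF elim] by (simp add: e_def J_def S_def)
      then show ?case
        by (simp add: \<rho>_def g_def power2_eq_square mult.commute[of "e _ h"])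
    qed
    have "S \<in> O[nhds 0](\<lambda>h. h ^ M)"
      unfolding S_def using XM by (intro big_sum_in_bigo) (simp add: e_def)
    then have "(\<lambda>h. S h * S h) \<in> O[nhds 0](\<lambda>h. h ^ (M + M))"
      by (intro bigo_power_mult)
    then have "(\<lambda>h. S h * S h) \<in> O[nhds 0](\<lambda>h. h ^ N)"
      by (rule bigo_power_mono) (use N in simp)
    with bigoI[OF \<rho>_bound] have \<rho>: "\<rho> \<in> O[nhds 0](\<lambda>h. h ^ N)"
      by (rule landau_o.big_trans)
    have "expands N (\<lambda>h. J l h * e l h) (\<lambda>k. \<Sum>i\<le>k. (a ^ i * jc l i) * c l (k - i))" if "l < m" for l
    proof (rule expands_mult)
      show "expands N (\<lambda>h. J l h) (\<lambda>i. a ^ i * jc l i)"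
        unfolding J_def using expands_rescale[OF expands_mono[OF jc[OF that] N(2)]] by simp
      show "expands N (\<lambda>h. e l h) (c l)" using Xc that by (simp add: e_def)
    qed
    then have "expands N (\<lambda>h. (\<Sum>l<m. J l h * e l h) + \<rho> h) (\<lambda>k. \<Sum>l<m. \<Sum>i\<le>k. a ^ i * jc l i * c l (k - i))"
      by (intro expands_add_bigo \<rho> expands_sum) auto
    then show "expands N (\<lambda>h. f (t0 + a * h) (X h) \<kappa> - slope \<kappa> (a * h))
       (\<lambda>k. \<Sum>l<m. \<Sum>i\<le>k. a ^ i * jc l i * c l (k - i))"
      by (simp add: \<rho>_def)
  qed
qed

text \<open>
  The Taylor coefficients \<open>g\<close> of the slope along the solution are the same for every quadrature formula; the
  formula enters only through its errors on monomials.
\<close>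

lemma quadrature_defect:
  assumes \<kappa>: "\<kappa> < m"
  shows "\<exists>g. \<forall>s w c a. expands 7 (\<lambda>h. y t0 \<kappa> + h * (\<Sum>j<s. w j * slope \<kappa> (c j * h)) - y (t0 + a * h) \<kappa>)
     (\<lambda>k. case k of 0 \<Rightarrow> 0 | Suc k \<Rightarrow> g k * ((\<Sum>j<(s::nat). w j * c j ^ k) - a ^ Suc k / real (Suc k)))"
proof -
  obtain g where g: "expands 6 (slope \<kappa>) g"
    using expands_along_solution[OF f_Ck[OF \<kappa>]] by auto
  have "\<forall>\<^sub>F h in nhds 0. ((\<lambda>h. y (t0 + h) \<kappa>) has_real_derivative slope \<kappa> h) (at h)"
    using near_0
  proof eventually_elim
    case (elim h)
    then show ?case
      using DERIV_shift[of "\<lambda>t. y t \<kappa>" "slope \<kappa> h" h t0] sol_deriv[OF elim \<kappa>] by (simp add: add.commute)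
  qed
  from expands_antiderivative[OF this g, unfolded add_0_right]
  have y: "expands 7 (\<lambda>h. y (t0 + h) \<kappa>) (\<lambda>k. case k of 0 \<Rightarrow> y t0 \<kappa> | Suc k \<Rightarrow> g k / real (Suc k))"
    by (simp del: of_nat_Suc)
  show ?thesis
  proof (intro exI[of _ g] allI)
    fix s w c a
    have "expands 6 (\<lambda>h. \<Sum>j<s. w j * slope \<kappa> (c j * h)) (\<lambda>k. \<Sum>j<s. w j * (c j ^ k * g k))"
      using expands_rescale[OF g] by (intro expands_sum expands_cmult) simp
    note expands_times_h[OF this]
    moreover have "Suc 6 = (7::nat)" by simp
    ultimately
    have 1: "expands 7 (\<lambda>h. h * (\<Sum>j<s. w j * slope \<kappa> (c j * h)))
        (\<lambda>k. case k of 0 \<Rightarrow> 0 | Suc k \<Rightarrow> \<Sum>j<s. w j * (c j ^ k * g k))"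
      by (simp only:)
    have 2: "expands 7 (\<lambda>h. y (t0 + a * h) \<kappa>) (\<lambda>k. a ^ k * (case k of 0 \<Rightarrow> y t0 \<kappa> | Suc k \<Rightarrow> g k / real (Suc k)))"
      using expands_rescale[OF y] by simp
    from expands_diff[OF expands_add[OF expands_const[of 7 "y t0 \<kappa>"] 1] 2]
    show "expands 7 (\<lambda>h. y t0 \<kappa> + h * (\<Sum>j<s. w j * slope \<kappa> (c j * h)) - y (t0 + a * h) \<kappa>)
     (\<lambda>k. case k of 0 \<Rightarrow> 0 | Suc k \<Rightarrow> g k * ((\<Sum>j<s. w j * c j ^ k) - a ^ Suc k / real (Suc k)))"
      by (rule expands_cong)
        (auto split: nat.split simp: right_diff_distrib sum_distrib_left mult_ac simp del: of_nat_Suc)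
  qed
qed

end

section \<open>The local error of a Runge-Kutta step\<close>

context ivp begin

text \<open>
  Fixed choices of the Taylor coefficients at \<open>t0\<close> of the slope and of the Jacobian along the solution,
  one component of the system at a time.
\<close>

definition sol_coeff :: "nat \<Rightarrow> nat \<Rightarrow> real" where
  "sol_coeff \<kappa> = (SOME g. \<forall>s w c a.
     expands 7 (\<lambda>h. y t0 \<kappa> + h * (\<Sum>j<s. w j * slope \<kappa> (c j * h)) - y (t0 + a * h) \<kappa>)
     (\<lambda>k. case k of 0 \<Rightarrow> 0 | Suc k \<Rightarrow> g k * ((\<Sum>j<(s::nat). w j * c j ^ k) - a ^ Suc k / real (Suc k))))"

definition jac_coeff :: "nat \<Rightarrow> nat \<Rightarrow> nat \<Rightarrow> real" where
  "jac_coeff \<kappa> = (SOME jc. \<forall>a X M N c. 1 \<le> M \<longrightarrow> N \<le> 2 * M \<longrightarrow> N \<le> 5 \<longrightarrow>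
     (\<forall>\<^sub>F h in nhds 0. \<forall>k\<ge>m. X h k = 0) \<longrightarrow>
     (\<forall>l<m. (\<lambda>h. X h l - y (t0 + a * h) l) \<in> O[nhds 0](\<lambda>h. h ^ M)) \<longrightarrow>
     (\<forall>l<m. expands N (\<lambda>h. X h l - y (t0 + a * h) l) (c l)) \<longrightarrow>
     expands N (\<lambda>h. f (t0 + a * h) (X h) \<kappa> - slope \<kappa> (a * h))
       (\<lambda>k. \<Sum>l<m. \<Sum>i\<le>k. a ^ i * jc l i * c l (k - i)))"

lemma sol_coeff:
  fixes s :: nat
  assumes "\<kappa> < m"
  shows "expands 7 (\<lambda>h. y t0 \<kappa> + h * (\<Sum>j<s. w j * slope \<kappa> (c j * h)) - y (t0 + a * h) \<kappa>)
     (\<lambda>k. case k of 0 \<Rightarrow> 0 | Suc k \<Rightarrow> sol_coeff \<kappa> k * ((\<Sum>j<s. w j * c j ^ k) - a ^ Suc k / real (Suc k)))"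
  by (rule someI_ex[OF quadrature_defect[OF assms], folded sol_coeff_def, rule_format])

lemma jac_coeff:
  assumes "\<kappa> < m" "1 \<le> M" "N \<le> 2 * M" "N \<le> 5" "\<forall>\<^sub>F h in nhds 0. \<forall>k\<ge>m. X h k = 0"
    and "\<And>l. l < m \<Longrightarrow> (\<lambda>h. X h l - y (t0 + a * h) l) \<in> O[nhds 0](\<lambda>h. h ^ M)"
    and "\<And>l. l < m \<Longrightarrow> expands N (\<lambda>h. X h l - y (t0 + a * h) l) (c l)"
  shows "expands N (\<lambda>h. f (t0 + a * h) (X h) \<kappa> - slope \<kappa> (a * h))
       (\<lambda>k. \<Sum>l<m. \<Sum>i\<le>k. a ^ i * jac_coeff \<kappa> l i * c l (k - i))"
  using assms(2-) by (rule someI_ex[OF perturbation[OF assms(1)], folded jac_coeff_def, rule_format])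

end

locale rk_ivp = ivp m D f y t0 \<epsilon> for m D f y t0 \<epsilon> +
  fixes s p :: nat and A :: "nat \<Rightarrow> nat \<Rightarrow> real" and b :: "nat \<Rightarrow> real"
  assumes cond: "rk_conditions p s A b"
begin

abbreviation "c \<equiv> rk_node s A"
abbreviation "K j h \<equiv> rk_stage s A f t0 (y t0) h j"

definition stage :: "nat \<Rightarrow> real \<Rightarrow> nat \<Rightarrow> real" where
  "stage i h k = y t0 k + h * (\<Sum>j<s. A i j * K j h k)"

definition err :: "nat \<Rightarrow> nat \<Rightarrow> real \<Rightarrow> real" where
  "err i \<kappa> h = stage i h \<kappa> - y (t0 + c i * h) \<kappa>"

definition slope_err :: "nat \<Rightarrow> nat \<Rightarrow> real \<Rightarrow> real" where
  "slope_err i \<kappa> h = f (t0 + c i * h) (stage i h) \<kappa> - slope \<kappa> (c i * h)"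

lemma p_le: "p \<le> 5" using cond by (auto simp: rk_conditions_def)

lemma A_upper: "i < s \<Longrightarrow> j < s \<Longrightarrow> i \<le> j \<Longrightarrow> A i j = 0"
  using cond by (auto simp: rk_conditions_def explicit_rk_def)

lemma K_eq:
  assumes "i < s"
  shows "K i h = f (t0 + c i * h) (stage i h)"
proof -
  have "(\<Sum>j<s. A i j * K j h k) = (\<Sum>j<i. A i j * K j h k)" for k
    using assms A_upper by (intro sum.mono_neutral_right) auto
  then have "stage i h = (\<lambda>k. y t0 k + h * (\<Sum>j<i. A i j * K j h k))"
    by (simp add: stage_def fun_eq_iff)
  then show ?thesis by (subst rk_stage.simps) simp
qed

text \<open>
  The recursion \<open>e = d + h A (J e) + \<dots>\<close>, still with the exact difference of the slopes in place of its
  linearization.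
\<close>

lemma err_eq:
  "err i \<kappa> h = (y t0 \<kappa> + h * (\<Sum>j<s. A i j * slope \<kappa> (c j * h)) - y (t0 + c i * h) \<kappa>) +
     h * (\<Sum>j<s. A i j * slope_err j \<kappa> h)"
  by (simp add: err_def stage_def slope_err_def K_eq right_diff_distrib sum_subtractf algebra_simps)

lemma residual_expands:
  assumes "\<kappa> < m"
  shows "expands 7 (\<lambda>h. y t0 \<kappa> + h * (\<Sum>j<s. A i j * slope \<kappa> (c j * h)) - y (t0 + c i * h) \<kappa>)
     (\<lambda>k. case k of 0 \<Rightarrow> 0 | Suc k \<Rightarrow> sol_coeff \<kappa> k * defect s A k i)"
  unfolding defect_def by (rule sol_coeff[OF assms])

lemma slope_err_expands:
  assumes "\<kappa> < m" "1 \<le> M" "N \<le> 2 * M" "N \<le> 5" "\<forall>\<^sub>F h in nhds 0. \<forall>k\<ge>m. stage i h k = 0"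
    and "\<And>l. l < m \<Longrightarrow> err i l \<in> O[nhds 0](\<lambda>h. h ^ M)"
    and "\<And>l. l < m \<Longrightarrow> expands N (err i l) (u l)"
  shows "expands N (slope_err i \<kappa>) (\<lambda>k. \<Sum>l<m. \<Sum>q\<le>k. c i ^ q * jac_coeff \<kappa> l q * u l (k - q))"
  unfolding slope_err_def using assms unfolding err_def by (rule jac_coeff)

lemma slope_err_bigo:
  assumes "\<kappa> < m" "1 \<le> M" "N \<le> M" "N \<le> 5" "\<forall>\<^sub>F h in nhds 0. \<forall>k\<ge>m. stage i h k = 0"
    and "\<And>l. l < m \<Longrightarrow> err i l \<in> O[nhds 0](\<lambda>h. h ^ M)"
  shows "slope_err i \<kappa> \<in> O[nhds 0](\<lambda>h. h ^ N)"
proof -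
  have "expands N (err i l) (\<lambda>_. 0)" if "l < m" for l
    by (intro bigo_expands bigo_power_mono[OF assms(6)[OF that] assms(3)])
  then have "expands N (slope_err i \<kappa>) (\<lambda>k. \<Sum>l<m. \<Sum>q\<le>k. c i ^ q * jac_coeff \<kappa> l q * 0)"
    using assms by (intro slope_err_expands[where M = M]) auto
  then show ?thesis by (rule expands_zero_coeffs) simp
qed

lemma err_bigo:
  assumes \<kappa>: "\<kappa> < m" and N: "N \<le> 6" and i: "i < s"
    and d: "\<And>k. k < N \<Longrightarrow> sol_coeff \<kappa> k * defect s A k i = 0"
    and "\<And>j. j < i \<Longrightarrow> slope_err j \<kappa> \<in> O[nhds 0](\<lambda>h. h ^ N)"
  shows "err i \<kappa> \<in> O[nhds 0](\<lambda>h. h ^ Suc N)"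
proof -
  have "expands (Suc N) (\<lambda>h. y t0 \<kappa> + h * (\<Sum>j<s. A i j * slope \<kappa> (c j * h)) - y (t0 + c i * h) \<kappa>)
      (\<lambda>k. case k of 0 \<Rightarrow> 0 | Suc k \<Rightarrow> sol_coeff \<kappa> k * defect s A k i)"
    by (rule expands_mono[OF residual_expands[OF \<kappa>]]) (use N in simp)
  then have 1: "(\<lambda>h. y t0 \<kappa> + h * (\<Sum>j<s. A i j * slope \<kappa> (c j * h)) - y (t0 + c i * h) \<kappa>) \<in> O[nhds 0](\<lambda>h. h ^ Suc N)"
    by (rule expands_zero_coeffs) (use d in \<open>auto split: nat.split\<close>)
  have "(\<lambda>h. \<Sum>j<s. A i j * slope_err j \<kappa> h) \<in> O[nhds 0](\<lambda>h. h ^ N)"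
  proof (rule big_sum_in_bigo)
    fix j assume "j \<in> {..<s}"
    then show "(\<lambda>h. A i j * slope_err j \<kappa> h) \<in> O[nhds 0](\<lambda>h. h ^ N)"
      using assms(5)[of j] A_upper[of i j] i by (cases "j < i") auto
  qed
  then have "(\<lambda>h. h ^ 1 * (\<Sum>j<s. A i j * slope_err j \<kappa> h)) \<in> O[nhds 0](\<lambda>h. h ^ (1 + N))"
    by (intro bigo_power_mult) auto
  with 1 have "(\<lambda>h. (y t0 \<kappa> + h * (\<Sum>j<s. A i j * slope \<kappa> (c j * h)) - y (t0 + c i * h) \<kappa>) +
     h * (\<Sum>j<s. A i j * slope_err j \<kappa> h)) \<in> O[nhds 0](\<lambda>h. h ^ Suc N)"
    by (intro sum_in_bigo(1)) simp_all
  then show ?thesis unfolding err_eq[abs_def] .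
qed

text \<open>
  The slopes may be used only once their arguments are known to lie in \<open>D\<close> for small \<open>h\<close>, as nothing is known
  about \<open>f\<close> elsewhere. As the method is explicit, this and the bound of the error follow together by
  induction on the stages.
\<close>

lemma stage_start:
  assumes "i < s"
  shows "(\<forall>\<kappa><m. err i \<kappa> \<in> O[nhds 0](\<lambda>h. h ^ 2)) \<and> (\<forall>\<^sub>F h in nhds 0. \<forall>k\<ge>m. stage i h k = 0)"
  using assms
proof (induction i rule: less_induct)
  case (less i)
  have IH1: "err j \<kappa> \<in> O[nhds 0](\<lambda>h. h ^ 2)" if "j < i" "\<kappa> < m" for j \<kappa>
    using less.IH[of j] less.prems that by auto
  have IH2: "\<forall>\<^sub>F h in nhds 0. \<forall>k\<ge>m. stage j h k = 0" if "j < i" for j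
    using less.IH[of j] less.prems that by auto
  have "err i \<kappa> \<in> O[nhds 0](\<lambda>h. h ^ 2)" if \<kappa>: "\<kappa> < m" for \<kappa>
  proof -
    have "slope_err j \<kappa> \<in> O[nhds 0](\<lambda>h. h ^ 1)" if "j < i" for j
      using IH1[OF that] IH2[OF that] by (intro slope_err_bigo[OF \<kappa>, where M = 2]) auto
    then have "err i \<kappa> \<in> O[nhds 0](\<lambda>h. h ^ Suc 1)"
      by (intro err_bigo[OF \<kappa>]) (use less.prems in \<open>auto simp: defect_0\<close>)
    then show ?thesis by (simp add: numeral_2_eq_2)
  qed
  moreover have "\<forall>\<^sub>F h in nhds 0. \<forall>k\<ge>m. stage i h k = 0"
  proof -
    obtain \<delta> where \<delta>: "\<delta> > 0" "cube m z0 \<delta> \<subseteq> D"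
      using continuous_cube[OF continuous_on_const[of D "0::real"] z0_D zero_less_one] by blast
    have "\<forall>\<^sub>F h in nhds 0. (t0 + c j * h, stage j h) \<in> cube m z0 \<delta>" if "j < i" for j
      using IH1[OF that] IH2[OF that] \<delta>(1)
      by (intro perturbed_near[where M = 2]) (auto simp: err_def[abs_def])
    then have "\<forall>\<^sub>F h in nhds 0. \<forall>j\<in>{..<i}. (t0 + c j * h, stage j h) \<in> cube m z0 \<delta>"
      by (intro eventually_ball_finite) auto
    then show ?thesis
    proof eventually_elim
      case (elim h)
      have "A i j * K j h k = 0" if "k \<ge> m" "j < s" for j k
      proof (cases "j < i")
        case True
        then have "(t0 + c j * h, stage j h) \<in> D" using elim \<delta>(2) by auto
        then show ?thesis using f_support[OF _ that(1)] K_eq[OF that(2)] by simp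
      next
        case False
        then show ?thesis using A_upper[of i j] less.prems that by simp
      qed
      then have "(\<Sum>j<s. A i j * K j h k) = 0" if "k \<ge> m" for k
        using that by (intro sum.neutral) blast
      then show ?case using D_support[OF z0_D] by (simp add: stage_def)
    qed
  qed
  ultimately show ?case by blast
qed

lemma err_2: "i < s \<Longrightarrow> \<kappa> < m \<Longrightarrow> err i \<kappa> \<in> O[nhds 0](\<lambda>h. h ^ 2)"
  and stage_support: "i < s \<Longrightarrow> \<forall>\<^sub>F h in nhds 0. \<forall>k\<ge>m. stage i h k = 0"
  using stage_start by blast+

text \<open>
  One application of \<open>h A J\<close> to an expansion of the stage errors: the power \<open>c\<^sub>j ^ q\<close> comes from the
  \<open>q\<close>-th Taylor coefficient of the Jacobian.
\<close>

lemma annihilated_next: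
  assumes u: "\<And>l k. l < m \<Longrightarrow> annihilated s A b (p - k) (u l k)"
  shows "annihilated s A b (p - Suc k)
    (\<lambda>i. \<Sum>j<s. A i j * (\<Sum>l<m. \<Sum>q\<le>k. c j ^ q * jac_coeff \<kappa> l q * u l (k - q) j))"
proof (cases "k < p")
  case True
  have "annihilated s A b (p - Suc k) (\<lambda>i. \<Sum>j<s. A i j * c j ^ q * u l (k - q) j)" if "l < m" "q \<le> k" for l q
  proof -
    have "p - (k - q) - Suc q = p - Suc k" using that True by simp
    then show ?thesis
      using annihilated_apply[OF u[OF that(1), of "k - q"], of q] that True by simp
  qed
  then have "annihilated s A b (p - Suc k) (\<lambda>i. \<Sum>l<m. 1 * (\<Sum>q\<le>k. jac_coeff \<kappa> l q * (\<Sum>j<s. A i j * c j ^ q * u l (k - q) j)))"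
    by (intro annihilated_sum) auto
  then show ?thesis
  proof (rule annihilated_cong)
    fix i
    have "(\<Sum>j<s. A i j * (\<Sum>l<m. \<Sum>q\<le>k. c j ^ q * jac_coeff \<kappa> l q * u l (k - q) j)) =
       (\<Sum>j<s. \<Sum>l<m. \<Sum>q\<le>k. jac_coeff \<kappa> l q * (A i j * c j ^ q * u l (k - q) j))"
      by (simp add: sum_distrib_left mult_ac)
    also have "\<dots> = (\<Sum>l<m. \<Sum>j<s. \<Sum>q\<le>k. jac_coeff \<kappa> l q * (A i j * c j ^ q * u l (k - q) j))"
      by (rule sum.swap)
    also have "\<dots> = (\<Sum>l<m. \<Sum>q\<le>k. \<Sum>j<s. jac_coeff \<kappa> l q * (A i j * c j ^ q * u l (k - q) j))"
      by (intro sum.cong refl sum.swap)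
    finally show "(\<Sum>l<m. 1 * (\<Sum>q\<le>k. jac_coeff \<kappa> l q * (\<Sum>j<s. A i j * c j ^ q * u l (k - q) j))) =
       (\<Sum>j<s. A i j * (\<Sum>l<m. \<Sum>q\<le>k. c j ^ q * jac_coeff \<kappa> l q * u l (k - q) j))"
      by (simp add: sum_distrib_left)
  qed
qed simp

lemma weights_next:
  assumes u: "\<And>l k. l < m \<Longrightarrow> annihilated s A b (p - k) (u l k)" and k: "k < p"
  shows "(\<Sum>i<s. b i * (\<Sum>l<m. \<Sum>q\<le>k. c i ^ q * jac_coeff \<kappa> l q * u l (k - q) i)) = 0"
proof -
  have *: "(\<Sum>i<s. b i * c i ^ q * u l (k - q) i) = 0" if "l < m" "q \<le> k" for l q
    using annihilated_weight[OF u[OF that(1), of "k - q"], of q] that k by simp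
  have "(\<Sum>i<s. b i * (\<Sum>l<m. \<Sum>q\<le>k. c i ^ q * jac_coeff \<kappa> l q * u l (k - q) i)) =
     (\<Sum>i<s. \<Sum>l<m. \<Sum>q\<le>k. jac_coeff \<kappa> l q * (b i * c i ^ q * u l (k - q) i))"
    by (simp add: sum_distrib_left mult_ac)
  also have "\<dots> = (\<Sum>l<m. \<Sum>i<s. \<Sum>q\<le>k. jac_coeff \<kappa> l q * (b i * c i ^ q * u l (k - q) i))"
    by (rule sum.swap)
  also have "\<dots> = (\<Sum>l<m. \<Sum>q\<le>k. \<Sum>i<s. jac_coeff \<kappa> l q * (b i * c i ^ q * u l (k - q) i))"
    by (intro sum.cong refl sum.swap)
  also have "\<dots> = 0"
    using * by (simp flip: sum_distrib_left)
  finally show ?thesis .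
qed

text \<open>
  Inserting an expansion with \<open>N\<close> terms into the right-hand side of the recursion yields one with \<open>N + 1\<close>
  terms. As \<open>N \<le> 4\<close> in this step, the quadratic remainder \<open>O(h\<^sup>4)\<close> is small enough. All coefficient vectors are
  built from defects by applying \<open>A C\<^sup>q\<close>, so they inherit the annihilation property.
\<close>

lemma err_expands:
  assumes "N \<le> 5"
  shows "\<exists>u. (\<forall>\<kappa><m. \<forall>k. annihilated s A b (p - k) (u \<kappa> k)) \<and>
     (\<forall>i<s. \<forall>\<kappa><m. expands N (err i \<kappa>) (\<lambda>k. u \<kappa> k i))"
  using assms
proof (induction N)
  case 0
  have "expands 0 (err i \<kappa>) (\<lambda>k. 0)" if "i < s" "\<kappa> < m" for i \<kappa>
    using bigo_power_mono[OF err_2[OF that], of 0] by (simp add: expands_def)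
  then show ?case
    by (intro exI[of _ "\<lambda>\<kappa> k i. 0"]) (simp add: annihilated_zero)
next
  case (Suc N)
  obtain u where u: "\<And>\<kappa> k. \<kappa> < m \<Longrightarrow> annihilated s A b (p - k) (u \<kappa> k)"
    and ex: "\<And>i \<kappa>. i < s \<Longrightarrow> \<kappa> < m \<Longrightarrow> expands N (err i \<kappa>) (\<lambda>k. u \<kappa> k i)"
    using Suc.IH[OF Suc_leD[OF Suc.prems]] by blast
  define v where "v = (\<lambda>\<kappa> k i. \<Sum>j<s. A i j * (\<Sum>l<m. \<Sum>q\<le>k. c j ^ q * jac_coeff \<kappa> l q * u l (k - q) j))"
  define u' where "u' = (\<lambda>\<kappa> k i. case k of 0 \<Rightarrow> 0 | Suc k \<Rightarrow> sol_coeff \<kappa> k * defect s A k i + v \<kappa> k i)"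
  have "annihilated s A b (p - k) (u' \<kappa> k)" if "\<kappa> < m" for \<kappa> k
  proof (cases k)
    case 0
    then show ?thesis by (simp add: u'_def annihilated_zero)
  next
    case (Suc k')
    have "annihilated s A b (p - Suc k') (defect s A k')"
      using cond by (simp add: rk_conditions_def)
    moreover have "annihilated s A b (p - Suc k') (v \<kappa> k')"
      unfolding v_def by (rule annihilated_next[OF u])
    ultimately show ?thesis
      unfolding u'_def Suc by (simp add: annihilated_add annihilated_scale)
  qed
  moreover have "expands (Suc N) (err i \<kappa>) (\<lambda>k. u' \<kappa> k i)" if i: "i < s" and \<kappa>: "\<kappa> < m" for i \<kappa>
  proof -
    have "expands N (slope_err j \<kappa>) (\<lambda>k. \<Sum>l<m. \<Sum>q\<le>k. c j ^ q * jac_coeff \<kappa> l q * u l (k - q) j)" if "j < s" for j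
      using ex[OF that] err_2[OF that] stage_support[OF that] Suc.prems
      by (intro slope_err_expands[where M = 2 and u = "\<lambda>l k. u l k j"] \<kappa>) auto
    then have "expands N (\<lambda>h. \<Sum>j<s. A i j * slope_err j \<kappa> h) (\<lambda>k. v \<kappa> k i)"
      unfolding v_def by (intro expands_sum expands_cmult) auto
    from expands_add[OF expands_mono[OF residual_expands[OF \<kappa>]] expands_times_h[OF this]]
    have "expands (Suc N) (err i \<kappa>) (\<lambda>k. (case k of 0 \<Rightarrow> 0 | Suc k \<Rightarrow> sol_coeff \<kappa> k * defect s A k i) +
        (case k of 0 \<Rightarrow> 0 | Suc k \<Rightarrow> v \<kappa> k i))"
      unfolding err_eq[abs_def] using Suc.prems by simp
    then show ?thesis
      by (rule expands_cong) (simp add: u'_def split: nat.split)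
  qed
  ultimately show ?case by (intro exI[of _ u']) blast
qed

text \<open>
  The error of the step is the quadrature error of \<open>b\<close> and \<open>h\<close> times the \<open>b\<close>-combination of the slope
  errors. All coefficients of the latter up to \<open>h ^ p\<close> vanish by annihilation.
\<close>

theorem local_error:
  assumes \<kappa>: "\<kappa> < m"
  shows "(\<lambda>h. y (t0 + h) \<kappa> - rk_step s A b f t0 (y t0) h \<kappa>) \<in> O[nhds 0](\<lambda>h. h ^ Suc p)"
proof -
  obtain u where u: "\<And>\<kappa> k. \<kappa> < m \<Longrightarrow> annihilated s A b (p - k) (u \<kappa> k)"
    and ex: "\<And>i \<kappa>. i < s \<Longrightarrow> \<kappa> < m \<Longrightarrow> expands p (err i \<kappa>) (\<lambda>k. u \<kappa> k i)"
    using err_expands[OF p_le] by blast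
  define w where "w = (\<lambda>i k. \<Sum>l<m. \<Sum>q\<le>k. c i ^ q * jac_coeff \<kappa> l q * u l (k - q) i)"
  have "expands p (\<lambda>h. b i * slope_err i \<kappa> h) (\<lambda>k. b i * w i k)" if i: "i < s" for i
  proof (cases "b i = 0")
    case False
    \<comment> \<open>The square of the stage error must be \<open>O(h ^ p)\<close>: an error \<open>O(h\<^sup>2)\<close> is enough unless \<open>p = 5\<close>.\<close>
    have "\<exists>M\<ge>1. p \<le> 2 * M \<and> (\<forall>l<m. err i l \<in> O[nhds 0](\<lambda>h. h ^ M))"
    proof (cases "p \<le> 4")
      case True
      then show ?thesis using err_2[OF i] by (intro exI[of _ 2]) auto
    next
      case False
      then have "b i * defect s A 1 i = 0"
        using cond i by (auto simp: rk_conditions_def)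
      then have d1: "defect s A 1 i = 0" using \<open>b i \<noteq> 0\<close> by simp
      have "err i l \<in> O[nhds 0](\<lambda>h. h ^ Suc 2)" if l: "l < m" for l
      proof (rule err_bigo[OF l _ i])
        fix k :: nat assume "k < 2"
        then have "k = 0 \<or> k = 1" by auto
        then show "sol_coeff l k * defect s A k i = 0"
          using defect_0 d1 by auto
      next
        fix j assume "j < i"
        then have "j < s" using i by simp
        then show "slope_err j l \<in> O[nhds 0](\<lambda>h. h ^ 2)"
          using err_2[of j] stage_support[of j] by (intro slope_err_bigo[OF l, where M = 2]) auto
      qed simp
      then show ?thesis using p_le by (intro exI[of _ "Suc 2"]) auto
    qed
    then obtain M where "1 \<le> M" "p \<le> 2 * M" "\<And>l. l < m \<Longrightarrow> err i l \<in> O[nhds 0](\<lambda>h. h ^ M)" by blast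
    then show ?thesis
      unfolding w_def using ex[OF i] stage_support[OF i] p_le
      by (intro expands_cmult slope_err_expands[where M = M and u = "\<lambda>l k. u l k i"] \<kappa>) auto
  qed (simp add: expands_def)
  then have "expands p (\<lambda>h. \<Sum>i<s. b i * slope_err i \<kappa> h) (\<lambda>k. \<Sum>i<s. b i * w i k)"
    by (intro expands_sum) auto
  then have "(\<lambda>h. \<Sum>i<s. b i * slope_err i \<kappa> h) \<in> O[nhds 0](\<lambda>h. h ^ p)"
    by (rule expands_zero_coeffs) (unfold w_def, rule weights_next[OF u])
  then have 1: "(\<lambda>h. h ^ 1 * (\<Sum>i<s. b i * slope_err i \<kappa> h)) \<in> O[nhds 0](\<lambda>h. h ^ (1 + p))"
    by (intro bigo_power_mult) auto
  have "expands (Suc p) (\<lambda>h. y t0 \<kappa> + h * (\<Sum>j<s. b j * slope \<kappa> (c j * h)) - y (t0 + 1 * h) \<kappa>)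
     (\<lambda>k. case k of 0 \<Rightarrow> 0 | Suc k \<Rightarrow> sol_coeff \<kappa> k * ((\<Sum>j<s. b j * c j ^ k) - 1 ^ Suc k / real (Suc k)))"
    by (rule expands_mono[OF sol_coeff[OF \<kappa>]]) (use p_le in simp)
  then have 2: "(\<lambda>h. y t0 \<kappa> + h * (\<Sum>j<s. b j * slope \<kappa> (c j * h)) - y (t0 + 1 * h) \<kappa>) \<in> O[nhds 0](\<lambda>h. h ^ Suc p)"
    by (rule expands_zero_coeffs)
      (use cond in \<open>auto simp: rk_conditions_def split: nat.split\<close>)
  have eq: "y (t0 + h) \<kappa> - rk_step s A b f t0 (y t0) h \<kappa> =
     - (y t0 \<kappa> + h * (\<Sum>j<s. b j * slope \<kappa> (c j * h)) - y (t0 + 1 * h) \<kappa>) - h ^ 1 * (\<Sum>i<s. b i * slope_err i \<kappa> h)" for h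
    by (simp add: rk_step_def slope_err_def K_eq right_diff_distrib sum_subtractf)
  show ?thesis
    unfolding eq
    by (rule sum_in_bigo(2)[OF landau_o.big.uminus_in_iff[THEN iffD2, OF 2] 1[unfolded plus_1_eq_Suc]])
qed

end

theorem rk_conditions_imp_order:
  assumes cond: "rk_conditions p s A b"
  shows "rk_has_order p s A b"
  unfolding rk_has_order_def
proof (intro exI[of _ 6] allI impI)
  fix m D f y t0 \<epsilon> k
  assume *: "Ck_system m 6 D f" "(\<epsilon>::real) > 0" "solves_system m D f y {t0 - \<epsilon><..<t0 + \<epsilon>}" and k: "k < m"
  interpret rk_ivp m D f y t0 \<epsilon> s p A b
    using * cond by unfold_locales (auto simp: Ck_system_def)
  show "(\<lambda>h. y (t0 + h) k - rk_step s A b f t0 (y t0) h k) \<in> O[at 0](\<lambda>h. h ^ (p + 1))"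
    using landau_o.big.filter_mono[OF at_within_le_nhds local_error[OF k]] by simp
qed

theorem rkrls_has_orderI:
  assumes "rk_conditions p s A b" "1 \<le> p" "1 \<le> s" "rk_node s A (s - 1) = 1"
    and "\<And>k. k < q \<Longrightarrow> defect s A k (s - 1) = 0"
    and "annihilated s A b (p - Suc q) (\<lambda>i. if i = 0 then 1 else 0)"
    and "1 \<le> q" "q \<le> 2" "p \<le> 4 \<or> q = 2" "q \<le> p"
  shows "rkrls_has_order p s A b"
  unfolding rkrls_has_order_def
proof (intro allI impI)
  fix n :: nat assume "2 \<le> n"
  then interpret reuse p q n s A b
    using assms by unfold_locales auto
  show "rk_has_order p (n * s) (composed_A n s A b) (composed_b n s b)"
    by (rule rk_conditions_imp_order[OF rk_conditions_composed])
qed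

section \<open>The four methods\<close>

text \<open>
  Explicit forms of the conditions for the numbers of remaining powers that occur.
\<close>

lemma annihilated_1: "annihilated s A b (Suc 0) v \<longleftrightarrow> (\<Sum>i<s. b i * v i) = 0"
  by (subst annihilated.simps) simp

lemma annihilated_2:
  "annihilated s A b 2 v \<longleftrightarrow> (\<Sum>i<s. b i * v i) = 0 \<and> (\<Sum>i<s. b i * rk_node s A i * v i) = 0 \<and>
     (\<Sum>i<s. b i * (\<Sum>j<s. A i j * v j)) = 0"
proof -
  have "(\<forall>m<2. P m) \<longleftrightarrow> P 0 \<and> P (1::nat)" for P
    by (auto simp: less_2_cases_iff)
  then show ?thesis
    unfolding annihilated.simps[of s A b 2 v] by (auto simp: annihilated_1)
qed

lemma annihilated_3:
  "annihilated s A b 3 v \<longleftrightarrow> (\<Sum>i<s. b i * v i) = 0 \<and> (\<Sum>i<s. b i * rk_node s A i * v i) = 0 \<and>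
     (\<Sum>i<s. b i * rk_node s A i ^ 2 * v i) = 0 \<and>
     annihilated s A b 2 (\<lambda>i. \<Sum>j<s. A i j * v j) \<and>
     (\<Sum>i<s. b i * (\<Sum>j<s. A i j * rk_node s A j * v j)) = 0"
proof -
  have "m < 3 \<longleftrightarrow> m = 0 \<or> m = 1 \<or> m = (2::nat)" for m
    by auto
  then have "(\<forall>m<3. P m) \<longleftrightarrow> P 0 \<and> P 1 \<and> P (2::nat)" for P
    by auto
  then show ?thesis
    unfolding annihilated.simps[of s A b 3 v] by (auto simp: annihilated_1 numeral_2_eq_2)
qed

lemma sum_small:
  fixes g :: "nat \<Rightarrow> real"
  shows "(\<Sum>i<2. g i) = g 0 + g 1"
    and "(\<Sum>i<3. g i) = g 0 + g 1 + g 2"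
    and "(\<Sum>i<4. g i) = g 0 + g 1 + g 2 + g 3"
    and "(\<Sum>i<6. g i) = g 0 + g 1 + g 2 + g 3 + g 4 + g 5"
  by (simp_all add: numeral_eq_Suc)

text \<open>
  Row \<open>i\<close> lists the \<open>i\<close> entries to the left of the diagonal.
\<close>

definition tableau :: "real list list \<Rightarrow> nat \<Rightarrow> nat \<Rightarrow> real" where
  "tableau R i j = (if j < i then R ! i ! j else 0)"

text \<open>
  Heun's method: with order two, the reused stage already has a small enough error.
\<close>

definition A2 :: "nat \<Rightarrow> nat \<Rightarrow> real" where
  "A2 i j = tableau [[], [1]] i j"

definition b2 :: "nat \<Rightarrow> real" where
  "b2 i = [1/2, 1/2] ! i"

text \<open>
  With \<open>b\<^sub>1 = 0\<close> and \<open>c\<^sub>3 = 1\<close>, the quadrature conditions of order three determine the Radau nodes \<open>1/3\<close> and \<open>1\<close>;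
  the remaining condition then fixes \<open>A\<close>.
\<close>

definition A3 :: "nat \<Rightarrow> nat \<Rightarrow> real" where
  "A3 i j = tableau [[], [1/3], [-1, 2]] i j"

definition b3 :: "nat \<Rightarrow> real" where
  "b3 i = [0, 3/4, 1/4] ! i"

text \<open>
  A method with node \<open>c\<^sub>3 = 0\<close>. The weights are those of Simpson's rule, where the weight \<open>1/6\<close> of the node \<open>0\<close> is
  given to the third stage so that \<open>b\<^sub>1 = 0\<close>.
\<close>

definition A4 :: "nat \<Rightarrow> nat \<Rightarrow> real" where
  "A4 i j = tableau [[], [1/2], [-1/2, 1/2], [-3/2, 3/2, 1]] i j"

definition b4 :: "nat \<Rightarrow> real" where
  "b4 i = [0, 2/3, 1/6, 1/6] ! i"

text \<open>
  A member of the family of six-stage methods of order five in which all stages but the second satisfy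
  \<open>defect s A 1 i = 0\<close>, \<open>b\<^sub>2 = 0\<close>, and \<open>b\<^sub>j (1 - c\<^sub>j)\<close> is the \<open>j\<close>-th entry of \<open>b\<^sup>T A\<close>. For \<open>b\<^sub>1 = 0\<close> the nodes \<open>1/5, 2/3, 0, 1\<close>
  have to satisfy one equation, the orthogonality of their nodal polynomial to the constants. The
  last condition with \<open>j = 1\<close> gives \<open>(b\<^sup>T A)\<^sub>1 = 0\<close>, and as the last stage has order two, \<open>q = 2\<close> is available.
\<close>

definition A6 :: "nat \<Rightarrow> nat \<Rightarrow> real" where
  "A6 i j = tableau [[], [1/2], [4/25, 1/25], [-1/9, 2/9, 5/9], [-3/14, -8/7, 5/7, 9/14],
     [1/35, -5/7, 0, 9/7, 2/5]] i j"

definition b6 :: "nat \<Rightarrow> real" where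
  "b6 i = [0, 0, 125/336, 27/56, 1/24, 5/48] ! i"

text \<open>
  The definitions are stated for applied arguments, so that unfolding them leaves the nodes and defects
  of a tableau intact and their computed values can be used for rewriting.
\<close>

lemmas tableaux = A2_def b2_def A3_def b3_def A4_def b4_def A6_def b6_def tableau_def

lemma explicit_tableaux: "explicit_rk s A2" "explicit_rk s A3" "explicit_rk s A4" "explicit_rk s A6"
  by (simp_all add: explicit_rk_def tableaux)

lemma nodes2: "rk_node 2 A2 0 = 0" "rk_node 2 A2 (Suc 0) = 1"
  by (simp_all add: rk_node_def sum_small tableaux)

lemma nodes3: "rk_node 3 A3 0 = 0" "rk_node 3 A3 (Suc 0) = 1/3" "rk_node 3 A3 2 = 1"
  by (simp_all add: rk_node_def sum_small tableaux)

lemma defects3: "defect 3 A3 (Suc 0) 0 = 0" "defect 3 A3 (Suc 0) (Suc 0) = -1/18"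
    "defect 3 A3 (Suc 0) 2 = 1/6"
  by (simp_all add: defect_def nodes3 sum_small tableaux power2_eq_square)

lemma nodes4: "rk_node 4 A4 0 = 0" "rk_node 4 A4 (Suc 0) = 1/2" "rk_node 4 A4 2 = 0" "rk_node 4 A4 3 = 1"
  by (simp_all add: rk_node_def sum_small tableaux)

lemma defects4:
  "defect 4 A4 (Suc 0) 0 = 0" "defect 4 A4 (Suc 0) (Suc 0) = -1/8"
  "defect 4 A4 (Suc 0) 2 = 1/4" "defect 4 A4 (Suc 0) 3 = 1/4"
  "defect 4 A4 2 0 = 0" "defect 4 A4 2 (Suc 0) = -1/24" "defect 4 A4 2 2 = 1/8" "defect 4 A4 2 3 = 1/24"
  by (simp_all add: defect_def nodes4 sum_small tableaux power_divide)

lemma nodes6: "rk_node 6 A6 0 = 0" "rk_node 6 A6 (Suc 0) = 1/2" "rk_node 6 A6 2 = 1/5"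
   "rk_node 6 A6 3 = 2/3" "rk_node 6 A6 4 = 0" "rk_node 6 A6 5 = 1"
  by (simp_all add: rk_node_def sum_small tableaux)

lemma defects6:
  "defect 6 A6 (Suc 0) 0 = 0" "defect 6 A6 (Suc 0) (Suc 0) = -1/8" "defect 6 A6 (Suc 0) 2 = 0"
  "defect 6 A6 (Suc 0) 3 = 0" "defect 6 A6 (Suc 0) 4 = 0" "defect 6 A6 (Suc 0) 5 = 0"
  "defect 6 A6 2 0 = 0" "defect 6 A6 2 (Suc 0) = -1/24" "defect 6 A6 2 2 = 11/1500"
  "defect 6 A6 2 3 = -17/810" "defect 6 A6 2 4 = 1/35" "defect 6 A6 2 5 = 5/84"
  "defect 6 A6 3 0 = 0" "defect 6 A6 3 (Suc 0) = -1/64" "defect 6 A6 3 2 = 23/5000"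
  "defect 6 A6 3 3 = -139/8100" "defect 6 A6 3 4 = 4/75" "defect 6 A6 3 5 = 1/24"
  by (simp_all add: defect_def nodes6 sum_small tableaux power_divide)

lemma conditions2: "rk_conditions 2 2 A2 b2"
  unfolding rk_conditions_def
proof (intro conjI allI impI)
  fix k :: nat
  show "(\<Sum>i<2. b2 i * rk_node 2 A2 i ^ k) = 1 / real (Suc k)" if k: "k < 2"
  proof -
    consider "k = 0" | "k = 1" using k by linarith
    then show ?thesis by cases (simp_all add: sum_small nodes2 tableaux)
  qed
  consider "k = 0" | "k \<ge> 1" by linarith
  then show "annihilated 2 A2 b2 (2 - Suc k) (defect 2 A2 k)"
    by cases (simp_all add: defect_0 annihilated_zero)
qed (simp_all add: explicit_tableaux)

lemma conditions3: "rk_conditions 3 3 A3 b3"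
  unfolding rk_conditions_def
proof (intro conjI allI impI)
  fix k :: nat
  show "(\<Sum>i<3. b3 i * rk_node 3 A3 i ^ k) = 1 / real (Suc k)" if k: "k < 3"
  proof -
    consider "k = 0" | "k = 1" | "k = 2" using k by linarith
    then show ?thesis by cases (simp_all add: sum_small nodes3 tableaux power_divide)
  qed
  consider "k = 0" | "k = 1" | "k \<ge> 2" by linarith
  then show "annihilated 3 A3 b3 (3 - Suc k) (defect 3 A3 k)"
    by cases (simp_all add: defect_0 annihilated_zero annihilated_1 sum_small defects3 tableaux)
qed (simp_all add: explicit_tableaux)

lemma conditions4: "rk_conditions 4 4 A4 b4"
  unfolding rk_conditions_def
proof (intro conjI allI impI)
  fix k :: nat
  show "(\<Sum>i<4. b4 i * rk_node 4 A4 i ^ k) = 1 / real (Suc k)" if k: "k < 4"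
  proof -
    consider "k = 0" | "k = 1" | "k = 2" | "k = 3" using k by linarith
    then show ?thesis by cases (simp_all add: sum_small nodes4 tableaux power_divide)
  qed
  consider "k = 0" | "k = 1" | "k = 2" | "k \<ge> 3" by linarith
  then show "annihilated 4 A4 b4 (4 - Suc k) (defect 4 A4 k)"
    by cases (simp_all add: defect_0 annihilated_zero annihilated_1 annihilated_2
        sum_small nodes4 defects4 tableaux)
qed (simp_all add: explicit_tableaux)

lemma conditions6: "rk_conditions 5 6 A6 b6"
  unfolding rk_conditions_def
proof (intro conjI allI impI)
  fix k :: nat
  show "(\<Sum>i<6. b6 i * rk_node 6 A6 i ^ k) = 1 / real (Suc k)" if k: "k < 5"
  proof -
    consider "k = 0" | "k = 1" | "k = 2" | "k = 3" | "k = 4" using k by linarith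
    then show ?thesis by cases (simp_all add: sum_small nodes6 tableaux power_divide)
  qed
  consider "k = 0" | "k = 1" | "k = 2" | "k = 3" | "k \<ge> 4" by linarith
  then show "annihilated 6 A6 b6 (5 - Suc k) (defect 6 A6 k)"
    by cases (simp_all add: defect_0 annihilated_zero annihilated_1 annihilated_2 annihilated_3
        sum_small nodes6 defects6 tableaux)
next
  have "b6 i * defect 6 A6 1 i = 0" if i: "i < 6" for i
  proof -
    consider "i = 0" | "i = 1" | "i = 2" | "i = 3" | "i = 4" | "i = 5" using i by linarith
    then show ?thesis by cases (simp_all add: defects6 tableaux)
  qed
  then show "(5::nat) \<le> 4 \<or> (5::nat) = 5 \<and> (\<forall>i<6. b6 i * defect 6 A6 1 i = 0)" by blast
qed (simp_all add: explicit_tableaux)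

theorem mainTheorem3:
  shows "\<forall>(p, s) \<in> {(2, 2), (3, 3), (4, 4), (5, 6)}. \<exists>A b.
           explicit_rk s A \<and> rk_node s A (s - 1) = 1 \<and>
           rk_has_order p s A b \<and> rkrls_has_order p s A b"
proof -
  have "rkrls_has_order 2 2 A2 b2"
    by (rule rkrls_has_orderI[where q = 1, OF conditions2]) (simp_all add: nodes2 defect_0)
  then have 2: "\<exists>A b. explicit_rk 2 A \<and> rk_node 2 A (2 - 1) = 1 \<and> rk_has_order 2 2 A b \<and> rkrls_has_order 2 2 A b"
    using rk_conditions_imp_order[OF conditions2]
    by (intro exI[of _ A2] exI[of _ b2]) (simp add: explicit_tableaux nodes2)
  have "annihilated 3 A3 b3 (3 - Suc 1) (\<lambda>i. if i = 0 then 1 else 0)"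
    by (simp add: annihilated_1 sum_small tableaux)
  then have "rkrls_has_order 3 3 A3 b3"
    by (intro rkrls_has_orderI[where q = 1, OF conditions3]) (simp_all add: nodes3 defect_0)
  then have 3: "\<exists>A b. explicit_rk 3 A \<and> rk_node 3 A (3 - 1) = 1 \<and> rk_has_order 3 3 A b \<and> rkrls_has_order 3 3 A b"
    using rk_conditions_imp_order[OF conditions3]
    by (intro exI[of _ A3] exI[of _ b3]) (simp add: explicit_tableaux nodes3)
  have "annihilated 4 A4 b4 (4 - Suc 1) (\<lambda>i. if i = 0 then 1 else 0)"
    by (simp add: annihilated_2 sum_small tableaux)
  then have "rkrls_has_order 4 4 A4 b4"
    by (intro rkrls_has_orderI[where q = 1, OF conditions4]) (simp_all add: nodes4 defect_0)
  then have 4: "\<exists>A b. explicit_rk 4 A \<and> rk_node 4 A (4 - 1) = 1 \<and> rk_has_order 4 4 A b \<and> rkrls_has_order 4 4 A b"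
    using rk_conditions_imp_order[OF conditions4]
    by (intro exI[of _ A4] exI[of _ b4]) (simp add: explicit_tableaux nodes4)
  have "annihilated 6 A6 b6 (5 - Suc 2) (\<lambda>i. if i = 0 then 1 else 0)"
    by (simp add: annihilated_2 sum_small tableaux)
  moreover have "defect 6 A6 k (6 - 1) = 0" if "k < 2" for k
    using that by (auto simp: less_2_cases_iff defect_0 defects6)
  ultimately have "rkrls_has_order 5 6 A6 b6"
    by (intro rkrls_has_orderI[where q = 2, OF conditions6]) (simp_all add: nodes6)
  then have 6: "\<exists>A b. explicit_rk 6 A \<and> rk_node 6 A (6 - 1) = 1 \<and> rk_has_order 5 6 A b \<and> rkrls_has_order 5 6 A b"
    using rk_conditions_imp_order[OF conditions6]
    by (intro exI[of _ A6] exI[of _ b6]) (simp add: explicit_tableaux nodes6)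
  show ?thesis using 2 3 4 6 by simp
qed

end
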